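(* In the setting of Algorithm 2 (see context), suppose the basis functions $\eta_k$ are bounded, let $m:=\sup_{x\in\operatorname{supp}(X)}\sum_{k=1}^K|\eta_k(x)|^2$, and let $\tau=(1-\epsilon)\lambda_*$ for some $\epsilon\in(0,1)$. Then $$E\Big[\int_{\mathbb{R}^D}|y(x)-\hat y_L(x)|^2\mu(dx)\Big]\le\Big(1+\frac{\lambda^*}{\lambda_*(1-\epsilon)}\Big)\inf_{\alpha\in\mathbb{R}^K}\int_{\mathbb{R}^D}|y(x)-\alpha^\top\eta(x)|^2\mu(dx)$$ $$\qquad+2K\exp\Big\{-\frac{3\epsilon^2L}{6m\lambda^*/\lambda_*^2+2\epsilon(m/\lambda_*+\lambda^*/\lambda_* )}\Big\}\int_{\mathbb{R}^D}|y(x)|^2\mu(dx).$$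
   Context: $X$ is an $\mathbb{R}^D$-valued random variable with law $\mu$, $y:\mathbb{R}^D\to\mathbb{R}$ is measurable and square integrable w.r.t. $\mu$, $Y=y(X)$, and $(X^{(l)},Y^{(l)})_{l=1,\dots,L}$ are i.i.d. copies of $(X,Y)$. $\eta=(\eta_1,\dots,\eta_K)^\top$ is a vector of measurable functions square integrable w.r.t. $\mu$, $R=(E[\eta_k(X)\eta_\kappa(X)])_{k,\kappa=1}^K$ has full rank, and $0<\lambda_*\le\lambda_{\min}(R)\le\lambda_{\max}(R)\le\lambda^*<\infty$. Algorithm 2 with threshold $\tau>0$: form the $L\times K$ matrix $A=(\eta_k(X^{(l)}))_{l,k}$ with singular values $s_1\ge\dots\ge s_K\ge0$; if $s_K^2\ge L\tau$ set $\alpha_L=A^+(Y^{(1)},\dots,Y^{(L)})^\top$ ($A^+$ the Moore–Penrose pseudoinverse, i.e. the least-squares coefficient vector), otherwise $\alpha_L=0\in\mathbb{R}^K$; return $\hat y_L(x)=\alpha_L^\top\eta(x)$. $\operatorname{supp}(X)$ is the set of $x$ such that every ball around $x$ is hit by $X$ with positive probability. *)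

theory Defs
  imports "HOL-Probability.Probability"
begin

definition eigvals :: "real^'n^'n \<Rightarrow> real set" where
  "eigvals M = {c. \<exists>v. v \<noteq> 0 \<and> M *v v = c *\<^sub>R v}"

definition pinv :: "real^'k^'l \<Rightarrow> real^'l^'k" where
  "pinv A = (THE P. A ** P ** A = A \<and> P ** A ** P = P \<and>
                    transpose (A ** P) = A ** P \<and> transpose (P ** A) = P ** A)"

text \<open>Square of the smallest singular value of an L x K matrix (there are K singular values
  s_1 >= ... >= s_K >= 0, their squares being the eigenvalues of A^T A).\<close>
definition min_sing_sq :: "real^'k^'l \<Rightarrow> real" where
  "min_sing_sq A = Min (eigvals (transpose A ** A))"

definition design_matrix :: "('d \<Rightarrow> real^'k) \<Rightarrow> ('l \<Rightarrow> 'd) \<Rightarrow> real^'k^'l" where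
  "design_matrix \<eta> xs = (\<chi> l k. \<eta> (xs l) $ k)"

definition alg2_coeff :: "real \<Rightarrow> ('d \<Rightarrow> real^'k) \<Rightarrow> ('d \<Rightarrow> real) \<Rightarrow> ('l::finite \<Rightarrow> 'd) \<Rightarrow> real^'k" where
  "alg2_coeff \<tau> \<eta> y xs =
     (let A = design_matrix \<eta> xs in
      if min_sing_sq A \<ge> real CARD('l) * \<tau> then pinv A *v (\<chi> l. y (xs l)) else 0)"

definition alg2_est :: "real \<Rightarrow> ('d \<Rightarrow> real^'k) \<Rightarrow> ('d \<Rightarrow> real) \<Rightarrow> ('l::finite \<Rightarrow> 'd) \<Rightarrow> 'd \<Rightarrow> real" where
  "alg2_est \<tau> \<eta> y xs x = alg2_coeff \<tau> \<eta> y xs \<bullet> \<eta> x"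

definition msupp :: "'d::metric_space measure \<Rightarrow> 'd set" where
  "msupp \<mu> = {x. \<forall>e>0. measure \<mu> (ball x e) > 0}"

end

theory Submission
  imports Defs
begin

text \<open>
  Let \<open>\<tau> = (1 - \<epsilon>) \<lambda>\<^sub>*\<close>, let \<open>a\<close> be the population least-squares coefficient vector and
  \<open>J\<close> its risk. When the empirical Gram matrix passes the threshold test, orthogonality and the
  bound \<open>|A\<^sup>+ r|\<^sup>2 \<le> |r|\<^sup>2 / (L \<tau>)\<close> give a risk of at most
  \<open>J + \<lambda>\<^sup>* |r|\<^sup>2 / (L \<tau>)\<close>, where \<open>r\<close> is the vector of residuals of \<open>a\<close>
  at the sample points, so that \<open>E |r|\<^sup>2 = L J\<close>; otherwise the risk is the second moment of \<open>y\<close>.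

  The failure probability is bounded by a lower-tail matrix Chernoff bound
  \<open>K exp (- \<epsilon>\<^sup>2 L \<lambda>\<^sub>* / (2 m))\<close>, which is stronger than the claimed Bernstein-type bound since
  \<open>\<lambda>\<^sub>* \<le> \<lambda>\<^sup>*\<close>. It comes from the exponential-moment method, where the summands are separated
  by a discrete form of the Golden-Thompson inequality: for symmetric \<open>X\<close>, \<open>Y\<close> and
  \<open>N = 2\<^sup>n\<close> one has \<open>tr (X Y)\<^sup>N \<le> tr X\<^sup>N Y\<^sup>N\<close>, applied to \<open>X = I + A/N\<close> and
  \<open>Y = I + B/N\<close>.
\<close>

subsection \<open>Symmetric matrices and a trace inequality for powers\<close>

text \<open>The inner product of matrices is the Frobenius one, which makes Cauchy-Schwarz available
  for traces.\<close>

lemma inner_matrix_eq_trace: "(A::real^'n^'m) \<bullet> B = trace (A ** transpose B)"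
  by (simp add: inner_vec_def trace_def matrix_matrix_mult_def transpose_def)

lemma norm_transpose [simp]: "norm (transpose A) = norm (A::real^'n^'m)"
proof -
  have "transpose A \<bullet> transpose A = A \<bullet> A"
    unfolding inner_matrix_eq_trace transpose_transpose by (rule trace_mul_sym)
  then show ?thesis by (simp add: norm_eq_sqrt_inner)
qed

lemma transpose_add: "transpose (A + B) = transpose A + transpose (B::real^'n^'m)"
  by (simp add: transpose_def vec_eq_iff)

lemma transpose_sum: "transpose (\<Sum>i\<in>I. f i) = (\<Sum>i\<in>I. transpose (f i :: real^'n^'m))"
  by (simp add: transpose_def vec_eq_iff)

lemma symmetric_swap_inner:
  fixes M :: "real^'n^'n"
  assumes "transpose M = M"
  shows "v \<bullet> (M *v w) = (M *v v) \<bullet> w"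
  by (simp only: assms flip: dot_lmul_matrix transpose_matrix_vector)

section \<open>Matrix powers under the trace\<close>

primrec mpow :: "real^'n^'n \<Rightarrow> nat \<Rightarrow> real^'n^'n" where
  "mpow A 0 = mat 1"
| "mpow A (Suc n) = A ** mpow A n"

lemma mpow_add: "mpow A (m + n) = mpow A m ** mpow A n"
  by (induction m) (simp_all add: matrix_mul_assoc)

lemma mpow_mult: "mpow A (m * n) = mpow (mpow A m) n"
  by (induction n) (simp_all add: mpow_add)

lemma mpow_square: "mpow (A ** A) (2^n) = mpow A (2^Suc n)"
  using mpow_mult[of A "Suc (Suc 0)" "2^n"] by (simp add: mult_2)

lemma mpow_commutes: "mpow A n ** A = A ** mpow A n"
  by (induction n) (simp_all flip: matrix_mul_assoc)

lemma transpose_mpow: "transpose (mpow A n) = mpow (transpose A) n"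
  by (induction n) (simp_all add: matrix_transpose_mul mpow_commutes)

lemma mpow_product_Suc: "mpow (A ** B) (Suc n) = A ** mpow (B ** A) n ** B"
  by (induction n) (simp_all add: matrix_mul_assoc)

lemma trace_mpow_swap:
  fixes A B :: "real^'n^'n"
  shows "trace (mpow (A ** B) n) = trace (mpow (B ** A) n)"
proof (cases n)
  case (Suc k)
  have "trace (mpow (A ** B) (Suc k)) = trace (B ** (A ** mpow (B ** A) k))"
    unfolding mpow_product_Suc by (rule trace_mul_sym)
  also have "\<dots> = trace (mpow (B ** A) (Suc k))" by (simp only: mpow.simps matrix_mul_assoc)
  finally show ?thesis by (simp only: Suc)
qed simp

text \<open>The two bounds are proved by a joint induction: each step of the first uses the second
  on \<open>X Y\<close>, and each step of the second uses the first on \<open>M M\<^sup>T\<close> and \<open>M\<^sup>T M\<close>.\<close>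

lemma trace_mpow_two_power_le:
  fixes X Y M :: "real^'n^'n"
  shows "(transpose X = X \<Longrightarrow> transpose Y = Y \<Longrightarrow>
            trace (mpow (X ** Y) (2^n)) \<le> trace (mpow X (2^n) ** mpow Y (2^n)))"
    and "trace (mpow M (2^Suc n)) \<le> trace (mpow (M ** transpose M) (2^n))"
proof (induction n arbitrary: X Y M)
  case 0
  {
    case 1
    then show ?case by simp
  next
    case (2 M)
    have "trace (M ** M) = M \<bullet> transpose M" by (simp add: inner_matrix_eq_trace)
    also have "\<dots> \<le> norm M * norm (transpose M)" by (rule norm_cauchy_schwarz)
    also have "\<dots> = M \<bullet> M" by (simp add: power2_norm_eq_inner flip: power2_eq_square)
    finally show ?case by (simp add: inner_matrix_eq_trace numeral_2_eq_2)
  }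
next
  case (Suc n)
  {
    case 1
    have "trace (mpow (X ** Y) (2^Suc n)) \<le> trace (mpow (X ** Y ** transpose (X ** Y)) (2^n))"
      by (rule Suc.IH(2))
    also have "X ** Y ** transpose (X ** Y) = X ** (Y ** Y ** X)"
      by (simp add: 1 matrix_transpose_mul matrix_mul_assoc)
    also have "trace (mpow \<dots> (2^n)) = trace (mpow (Y ** Y ** X ** X) (2^n))"
      by (rule trace_mpow_swap)
    also have "\<dots> = trace (mpow ((X ** X) ** (Y ** Y)) (2^n))"
      using trace_mpow_swap[of "Y ** Y" "X ** X"] by (simp add: matrix_mul_assoc)
    also have "\<dots> \<le> trace (mpow (X ** X) (2^n) ** mpow (Y ** Y) (2^n))"
      by (rule Suc.IH(1)) (simp_all add: 1 matrix_transpose_mul)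
    finally show ?case by (simp only: mpow_square)
  next
    case (2 M)
    let ?F = "transpose M ** M" and ?G = "M ** transpose M"
    let ?Fk = "mpow ?F (2^n)" and ?Gk = "mpow ?G (2^n)"
    have sym: "transpose ?F = ?F" "transpose ?G = ?G"
      by (simp_all add: matrix_transpose_mul)
    have dbl: "trace (mpow Z (2^Suc n)) = (norm (mpow Z (2^n)))\<^sup>2"
      if "transpose Z = Z" for Z :: "real^'n^'n"
    proof -
      have "mpow Z (2^Suc n) = mpow Z (2^n) ** mpow Z (2^n)"
        by (simp add: mult_2 mpow_add)
      also have "\<dots> = mpow Z (2^n) ** transpose (mpow Z (2^n))"
        by (simp add: transpose_mpow that)
      finally show ?thesis by (simp add: power2_norm_eq_inner inner_matrix_eq_trace)
    qed
    have "trace (mpow M (2^Suc (Suc n))) \<le> trace (mpow (M ** M ** transpose (M ** M)) (2^n))"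
      using Suc.IH(2)[of "M ** M"] by (simp only: mpow_square)
    also have "M ** M ** transpose (M ** M) = M ** (M ** transpose M ** transpose M)"
      by (simp add: matrix_transpose_mul matrix_mul_assoc)
    also have "trace (mpow \<dots> (2^n)) = trace (mpow (M ** transpose M ** transpose M ** M) (2^n))"
      by (rule trace_mpow_swap)
    also have "\<dots> = trace (mpow (?G ** ?F) (2^n))"
      by (simp add: matrix_mul_assoc)
    also have "\<dots> \<le> trace (?Gk ** ?Fk)"
      by (rule Suc.IH(1)[OF sym(2) sym(1)])
    also have "\<dots> = ?Gk \<bullet> ?Fk"
      by (simp add: inner_matrix_eq_trace transpose_mpow sym)
    also have "\<dots> \<le> norm ?Gk * norm ?Fk" by (rule norm_cauchy_schwarz)
    \<comment> \<open>By cyclicity the powers of \<open>?F\<close> and \<open>?G\<close> have equal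
      traces, so the two Frobenius norms coincide and the Cauchy-Schwarz product becomes a single
      trace.\<close>
    also have "(norm ?Fk)\<^sup>2 = (norm ?Gk)\<^sup>2"
      using dbl[OF sym(1)] dbl[OF sym(2)] trace_mpow_swap[of M "transpose M" "2^Suc n"]
      by (simp only:)
    then have "norm ?Fk = norm ?Gk" by (simp only: power2_eq_iff_nonneg norm_ge_zero)
    also have "norm ?Gk * norm ?Gk = trace (mpow ?G (2^Suc n))"
      using dbl[OF sym(2)] by (simp add: power2_eq_square)
    finally show ?case .
  }
qed

section \<open>Extremal eigenvectors and the spectrum of a symmetric matrix\<close>

text \<open>The Rayleigh quotient has a minimiser by compactness of the unit sphere. The minimiser
  is an eigenvector, because otherwise moving it along its residual
  \<open>M *v v - c *\<^sub>R v\<close> would lower the quotient further.\<close>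

lemma symmetric_min_eigenvector:
  fixes M :: "real^'n^'n"
  assumes sym: "transpose M = M"
  shows "\<exists>c v. norm v = 1 \<and> M *v v = c *\<^sub>R v \<and> (\<forall>w. c * (w \<bullet> w) \<le> w \<bullet> (M *v w))"
proof -
  have "compact (sphere (0::real^'n) 1)" "sphere (0::real^'n) 1 \<noteq> {}" by auto
  moreover have "continuous_on (sphere 0 1) (\<lambda>w. w \<bullet> (M *v w))"
    by (intro continuous_intros linear_continuous_on matrix_vector_mul_bounded_linear)
  ultimately obtain v where v: "norm v = 1"
      and vmin: "\<And>w. norm w = 1 \<Longrightarrow> v \<bullet> (M *v v) \<le> w \<bullet> (M *v w)"
    using continuous_attains_inf[of "sphere 0 1" "\<lambda>w. w \<bullet> (M *v w)"] by auto
  define c where "c = v \<bullet> (M *v v)"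
  have le: "c * (w \<bullet> w) \<le> w \<bullet> (M *v w)" for w
  proof (cases "w = 0")
    case False
    define u where "u = w /\<^sub>R norm w"
    have w: "w = norm w *\<^sub>R u" and "norm u = 1" using False by (simp_all add: u_def)
    then have "c \<le> u \<bullet> (M *v u)" using vmin c_def by simp
    then have "(norm w)\<^sup>2 * c \<le> (norm w)\<^sup>2 * (u \<bullet> (M *v u))" by (simp add: mult_left_mono)
    also have "\<dots> = w \<bullet> (M *v w)"
      by (subst (2 3) w) (simp add: matrix_vector_mult_scaleR power2_eq_square)
    finally show ?thesis by (simp add: power2_norm_eq_inner mult.commute)
  qed simp
  define z where "z = M *v v - c *\<^sub>R v"
  define p where "p = z \<bullet> (M *v z) - c * (z \<bullet> z)"
  have p: "p \<ge> 0" using le[of z] by (simp add: p_def)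
  have vv: "v \<bullet> v = 1" using v by (simp add: norm_eq_1)
  \<comment> \<open>This is \<open>le\<close> along the line \<open>v + t *\<^sub>R z\<close>: the
    constant terms cancel by the choice of \<open>c\<close>, leaving a quadratic in \<open>t\<close>
    with slope \<open>2 * (z \<bullet> z)\<close> at zero.\<close>
  have key: "0 \<le> 2 * t * (z \<bullet> z) + t\<^sup>2 * p" for t
  proof -
    have zv: "z \<bullet> (M *v v) = z \<bullet> z + c * (z \<bullet> v)" by (simp add: z_def inner_diff_right)
    have vz: "v \<bullet> (M *v z) = z \<bullet> (M *v v)"
      using symmetric_swap_inner[OF sym, of v z] by (simp add: inner_commute)
    have "0 \<le> (v + t *\<^sub>R z) \<bullet> (M *v (v + t *\<^sub>R z)) - c * ((v + t *\<^sub>R z) \<bullet> (v + t *\<^sub>R z))"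
      using le[of "v + t *\<^sub>R z"] by simp
    also have "\<dots> = 2 * t * (z \<bullet> z) + t\<^sup>2 * p"
      by (simp add: matrix_vector_right_distrib matrix_vector_mult_scaleR inner_add_left inner_add_right
          vz zv c_def[symmetric] vv p_def algebra_simps power2_eq_square inner_commute[of v z])
    finally show ?thesis .
  qed
  have "z \<bullet> z = 0"
  proof (rule ccontr)
    assume "z \<bullet> z \<noteq> 0"
    then have pos: "z \<bullet> z > 0" by simp
    \<comment> \<open>A negative step short enough for the linear term to beat the quadratic one;
      the \<open>+ 1\<close> keeps the denominator positive when \<open>p = 0\<close>.\<close>
    define t where "t = - (z \<bullet> z) / (p + 1)"
    have "t * p = - (z \<bullet> z) - t" using p by (simp add: t_def field_simps)
    then have "2 * t * (z \<bullet> z) + t\<^sup>2 * p = t * (z \<bullet> z - t)"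
      by (simp add: power2_eq_square right_diff_distrib mult.assoc)
    moreover have "t < 0" using p pos by (simp add: t_def divide_neg_pos)
    then have "t * (z \<bullet> z - t) < 0" using pos mult_neg_pos[of t "z \<bullet> z - t"] by linarith
    ultimately show False using key[of t] by linarith
  qed
  then have "M *v v = c *\<^sub>R v" by (simp add: z_def)
  with v le show ?thesis by blast
qed

text \<open>Eigenvectors for distinct eigenvalues are orthogonal, and a pairwise orthogonal set is
  finite in finite dimension. Finiteness gives \<open>Min\<close> in \<open>min_sing_sq\<close> its
  meaning.\<close>

lemma finite_eigvals:
  fixes M :: "real^'n^'n"
  assumes sym: "transpose M = M"
  shows "finite (eigvals M)"
proof -
  have "\<forall>c\<in>eigvals M. \<exists>v. v \<noteq> 0 \<and> M *v v = c *\<^sub>R v"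
    by (auto simp: eigvals_def)
  from bchoice[OF this] obtain e where e: "\<And>c. c \<in> eigvals M \<Longrightarrow> e c \<noteq> 0 \<and> M *v e c = c *\<^sub>R e c"
    by blast
  have orth: "e a \<bullet> e b = 0" if "a \<in> eigvals M" "b \<in> eigvals M" "a \<noteq> b" for a b
  proof -
    have "b * (e a \<bullet> e b) = a * (e a \<bullet> e b)"
      using symmetric_swap_inner[OF sym, of "e a" "e b"] e[OF that(1)] e[OF that(2)] by simp
    then show ?thesis using that(3) by simp
  qed
  have "inj_on e (eigvals M)"
  proof (rule inj_onI, rule ccontr)
    fix a b assume "a \<in> eigvals M" "b \<in> eigvals M" "e a = e b" "a \<noteq> b"
    then show False using orth[of a b] e[of a] by simp
  qed
  moreover have "pairwise orthogonal (e ` eigvals M)"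
  proof (rule pairwiseI)
    fix v w assume "v \<in> e ` eigvals M" "w \<in> e ` eigvals M" "v \<noteq> w"
    then show "orthogonal v w" using orth unfolding orthogonal_def by blast
  qed
  then have "finite (e ` eigvals M)" by (rule pairwise_orthogonal_imp_finite)
  ultimately show ?thesis by (metis finite_imageD)
qed

subsection \<open>A discrete Golden-Thompson inequality\<close>

text \<open>A bound on the operator norm, kept as a predicate so that it passes through sums and
  products by plain inequalities.\<close>

definition mbound :: "real^'n^'m \<Rightarrow> real \<Rightarrow> bool" where
  "mbound A a \<longleftrightarrow> (\<forall>v. norm (A *v v) \<le> a * norm v)"

lemma mboundD: "mbound A a \<Longrightarrow> norm (A *v v) \<le> a * norm v"
  by (simp add: mbound_def)

lemma mbound_mpow:
  assumes "mbound A a" "0 \<le> a"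
  shows "norm (mpow A n *v v) \<le> a ^ n * norm v"
proof (induction n)
  case (Suc n)
  have "norm (mpow A (Suc n) *v v) \<le> a * norm (mpow A n *v v)"
    using mboundD[OF assms(1)] by (simp flip: matrix_vector_mul_assoc)
  also have "\<dots> \<le> a * (a ^ n * norm v)" using Suc assms(2) by (rule mult_left_mono)
  finally show ?case by (simp add: mult.assoc)
qed simp

text \<open>Telescoping: U^(n+1) - V^(n+1) = U (U^n - V^n) + (U - V) V^n. The assumption
  \<open>1 \<le> u\<close> allows all powers of \<open>u\<close> to be enlarged to the highest
  one.\<close>

lemma norm_mpow_diff_le:
  assumes U: "mbound U u" and V: "mbound V u" and u: "1 \<le> u" and d: "0 \<le> d"
    and UV: "\<And>v. norm (U *v v - V *v v) \<le> d * norm v"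
  shows "norm (mpow U n *v v - mpow V n *v v) \<le> real n * d * u ^ n * norm v"
proof (induction n)
  case (Suc n)
  let ?x = "mpow U n *v v" and ?y = "mpow V n *v v"
  have "norm (mpow U (Suc n) *v v - mpow V (Suc n) *v v)
      = norm (U *v (?x - ?y) + (U *v ?y - V *v ?y))"
    by (simp add: matrix_vector_mult_diff_distrib flip: matrix_vector_mul_assoc)
  also have "\<dots> \<le> u * norm (?x - ?y) + d * norm ?y"
    by (rule norm_triangle_le) (rule add_mono[OF mboundD[OF U] UV])
  also have "\<dots> \<le> u * (real n * d * u ^ n * norm v) + d * (u ^ n * norm v)"
    using Suc mbound_mpow[OF V, of n v] u d by (intro add_mono mult_left_mono) auto
  also have "d * (u ^ n * norm v) \<le> d * (u ^ Suc n * norm v)"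
    using u d by (intro mult_left_mono mult_right_mono power_increasing) auto
  finally show ?case by (simp add: algebra_simps)
qed simp

text \<open>A diagonal entry is a component of the image of a unit basis vector, hence bounded by
  the operator norm.\<close>

lemma abs_trace_diff_le:
  fixes U V :: "real^'n^'n"
  assumes "\<And>v. norm (U *v v - V *v v) \<le> d * norm v"
  shows "\<bar>trace U - trace V\<bar> \<le> real CARD('n) * d"
proof -
  have "\<bar>U $ i $ i - V $ i $ i\<bar> \<le> d" for i
  proof -
    have "\<bar>U $ i $ i - V $ i $ i\<bar> = \<bar>(U *v axis i 1 - V *v axis i 1) $ i\<bar>"
      by (simp add: matrix_vector_mult_basis column_def)
    also have "\<dots> \<le> norm (U *v axis i 1 - V *v axis i 1)" by (rule component_le_norm_cart)
    also have "\<dots> \<le> d" using assms[of "axis i 1"] by simp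
    finally show ?thesis .
  qed
  then have "(\<Sum>i\<in>UNIV. \<bar>U $ i $ i - V $ i $ i\<bar>) \<le> real CARD('n) * d"
    by (intro sum_bounded_above) auto
  moreover have "\<bar>trace U - trace V\<bar> \<le> (\<Sum>i\<in>UNIV. \<bar>U $ i $ i - V $ i $ i\<bar>)"
    by (simp add: trace_def flip: sum_subtractf)
  ultimately show ?thesis by linarith
qed

text \<open>A polynomial substitute for the matrix exponential; all estimates below are uniform in
  \<open>N\<close> up to an error \<open>O(1/N)\<close>, so \<open>N \<rightarrow> \<infinity>\<close> is only taken at the very end.\<close>

definition pexp :: "nat \<Rightarrow> real^'n^'n \<Rightarrow> real^'n^'n" where
  "pexp N A = mpow (mat 1 + (1 / real N) *\<^sub>R A) N"

lemma transpose_pexp_base: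
  fixes A :: "real^'n^'n"
  assumes "transpose A = A"
  shows "transpose (mat 1 + c *\<^sub>R A) = mat 1 + c *\<^sub>R A"
  by (simp add: transpose_add transpose_scalar assms)

lemma mbound_pexp_base:
  assumes "mbound A a" "0 \<le> c"
  shows "mbound (mat 1 + c *\<^sub>R A) (1 + c * a)"
  unfolding mbound_def
proof
  fix v
  have "norm ((mat 1 + c *\<^sub>R A) *v v) = norm (v + c *\<^sub>R (A *v v))"
    by (simp add: matrix_vector_mult_add_rdistrib scaleR_matrix_vector_assoc[symmetric])
  also have "\<dots> \<le> norm v + c * norm (A *v v)"
    using assms(2) norm_triangle_ineq[of v "c *\<^sub>R (A *v v)"] by simp
  also have "\<dots> \<le> norm v + c * (a * norm v)"
    using mboundD[OF assms(1), of v] assms(2) by (simp add: mult_left_mono)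
  finally show "norm ((mat 1 + c *\<^sub>R A) *v v) \<le> (1 + c * a) * norm v"
    by (simp add: algebra_simps)
qed

lemma mbound_add: "mbound A a \<Longrightarrow> mbound B b \<Longrightarrow> mbound (A + B) (a + b)"
  unfolding mbound_def
  by (auto simp: matrix_vector_mult_add_rdistrib distrib_right intro: norm_triangle_le add_mono)

lemma mbound_mult:
  assumes "mbound A a" "mbound B b" "0 \<le> a"
  shows "mbound (A ** B) (a * b)"
  unfolding mbound_def
proof
  fix v
  have "norm ((A ** B) *v v) \<le> a * norm (B *v v)"
    using mboundD[OF assms(1)] by (simp flip: matrix_vector_mul_assoc)
  also have "\<dots> \<le> a * (b * norm v)"
    using mboundD[OF assms(2)] assms(3) by (rule mult_left_mono)
  finally show "norm ((A ** B) *v v) \<le> a * b * norm v" by (simp add: mult.assoc)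
qed

text \<open>With \<open>c = 1 / N\<close>, the product of the bases for \<open>A\<close> and
  \<open>B\<close> differs from the base for \<open>A + B\<close> by
  \<open>c\<^sup>2 *\<^sub>R (A ** B)\<close> only. Over \<open>N\<close> factors this costs O(1/N),
  and the trace inequality for powers of two then separates \<open>A\<close> from
  \<open>B\<close>.\<close>

lemma trace_pexp_add_le:
  fixes A B :: "real^'n^'n"
  assumes sym: "transpose A = A" "transpose B = B"
    and bd: "mbound A a" "mbound B b" "0 \<le> a" "0 \<le> b"
    and N: "N = 2 ^ n"
  shows "trace (pexp N (A + B)) \<le> trace (pexp N A ** pexp N B)
           + real CARD('n) * a * b * exp (a + b) / real N"
proof -
  have Npos: "real N > 0" by (simp add: N)
  define c where "c = 1 / real N"
  have c: "c > 0" "real N * c = 1" using Npos by (simp_all add: c_def)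
  let ?X = "mat 1 + c *\<^sub>R A" and ?Y = "mat 1 + c *\<^sub>R B"
  let ?U = "mat 1 + c *\<^sub>R (A + B)"
  \<comment> \<open>\<open>u\<close> dominates both bases in operator norm, while
    \<open>u ^ N\<close> stays below \<open>exp (a + b)\<close> for every \<open>N\<close>.\<close>
  define u where "u = (1 + c * a) * (1 + c * b)"
  have u1: "1 \<le> u"
    unfolding u_def using c bd by (simp add: algebra_simps)
  have "mbound ?U (1 + c * (a + b))"
    using c bd by (intro mbound_pexp_base mbound_add) auto
  moreover have "1 + c * (a + b) \<le> u"
    unfolding u_def using c bd by (simp add: algebra_simps)
  ultimately have U: "mbound ?U u"
    unfolding mbound_def by (meson mult_right_mono norm_ge_zero order_trans)
  have V: "mbound (?X ** ?Y) u"
    unfolding u_def using c bd by (intro mbound_mult mbound_pexp_base) auto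
  have UV: "norm (?U *v v - (?X ** ?Y) *v v) \<le> (c\<^sup>2 * (a * b)) * norm v" for v
  proof -
    have "(?X ** ?Y) *v v - ?U *v v = c\<^sup>2 *\<^sub>R (A *v (B *v v))"
      by (simp add: matrix_vector_mult_add_rdistrib scaleR_matrix_vector_assoc[symmetric] matrix_vector_right_distrib
          matrix_vector_mult_scaleR power2_eq_square scaleR_add_right flip: matrix_vector_mul_assoc)
    then have "norm (?U *v v - (?X ** ?Y) *v v) = c\<^sup>2 * norm (A *v (B *v v))"
      by (subst norm_minus_commute) simp
    also have "norm (A *v (B *v v)) \<le> a * b * norm v"
      using mboundD[OF mbound_mult[OF bd(1,2,3)]] by (simp flip: matrix_vector_mul_assoc)
    finally show ?thesis by (simp add: mult_left_mono mult.assoc)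
  qed
  have "u ^ N \<le> exp (a + b)"
  proof -
    have "u ^ N = (1 + a / real N) ^ N * (1 + b / real N) ^ N"
      by (simp add: u_def power_mult_distrib c_def)
    also have "\<dots> \<le> exp a * exp b"
      using bd Npos by (intro mult_mono exp_ge_one_plus_x_over_n_power_n) auto
    finally show ?thesis by (simp add: exp_add)
  qed
  then have "real N * (c\<^sup>2 * (a * b)) * u ^ N \<le> real N * (c\<^sup>2 * (a * b)) * exp (a + b)"
    using bd by (intro mult_left_mono) auto
  also have "\<dots> = a * b * exp (a + b) / real N"
    using Npos by (simp add: c_def power2_eq_square)
  finally have err: "real N * (c\<^sup>2 * (a * b)) * u ^ N \<le> a * b * exp (a + b) / real N" .
  have "\<bar>trace (mpow ?U N) - trace (mpow (?X ** ?Y) N)\<bar>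
      \<le> real CARD('n) * (real N * (c\<^sup>2 * (a * b)) * u ^ N)"
    using norm_mpow_diff_le[OF U V u1 _ UV] bd by (intro abs_trace_diff_le) auto
  also have "\<dots> \<le> real CARD('n) * (a * b * exp (a + b) / real N)"
    using err by (rule mult_left_mono) simp
  finally have "trace (mpow ?U N) \<le> trace (mpow (?X ** ?Y) N) + real CARD('n) * a * b * exp (a + b) / real N"
    by (simp add: mult.assoc)
  also have "trace (mpow (?X ** ?Y) N) \<le> trace (mpow ?X N ** mpow ?Y N)"
    unfolding N using sym by (intro trace_mpow_two_power_le transpose_pexp_base)
  finally show ?thesis by (simp add: pexp_def c_def)
qed

section \<open>Rank-one matrices and the trace of \<open>pexp\<close> as a sum of quadratic
  forms\<close>

definition outer :: "real^'n \<Rightarrow> real^'n^'n" where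
  "outer x = (\<chi> i j. x $ i * x $ j)"

lemma outer_mult_vec: "outer x *v v = (x \<bullet> v) *\<^sub>R x"
  by (simp add: outer_def vec_eq_iff matrix_vector_mult_def inner_vec_def sum_distrib_left sum_distrib_right mult_ac)

lemma transpose_outer [simp]: "transpose (outer x) = outer x"
  by (simp add: outer_def transpose_def mult.commute)

lemma mbound_outer: "mbound (outer x) (x \<bullet> x)"
  unfolding mbound_def
proof
  fix v
  have "norm (outer x *v v) \<le> norm x * norm v * norm x"
    by (simp add: outer_mult_vec mult_right_mono Cauchy_Schwarz_ineq2)
  then show "norm (outer x *v v) \<le> (x \<bullet> x) * norm v"
    by (simp add: mult_ac flip: power2_norm_eq_inner power2_eq_square)
qed

text \<open>The lower bound on \<open>h\<close> is the second-order Bonferroni estimate of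
  \<open>(1 - (1 - u r)\<^sup>n) / r\<close> with \<open>r = x \<bullet> x\<close>.\<close>

lemma mpow_outer:
  assumes "0 \<le> u" "u * (x \<bullet> x) \<le> 1"
  shows "\<exists>h. real n * u - (real n)\<^sup>2 * u\<^sup>2 * (x \<bullet> x) / 2 \<le> h \<and>
             (\<forall>v. mpow (mat 1 - u *\<^sub>R outer x) n *v v = v - (h * (x \<bullet> v)) *\<^sub>R x)"
proof (induction n)
  case 0
  show ?case by (intro exI[of _ 0]) simp
next
  case (Suc n)
  let ?r = "x \<bullet> x"
  from Suc obtain h where h: "real n * u - (real n)\<^sup>2 * u\<^sup>2 * ?r / 2 \<le> h"
      "\<And>v. mpow (mat 1 - u *\<^sub>R outer x) n *v v = v - (h * (x \<bullet> v)) *\<^sub>R x" by blast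
  have "mpow (mat 1 - u *\<^sub>R outer x) (Suc n) *v v = v - ((h * (1 - u * ?r) + u) * (x \<bullet> v)) *\<^sub>R x" for v
    by (simp add: h(2) matrix_vector_mult_diff_rdistrib scaleR_matrix_vector_assoc[symmetric] outer_mult_vec
        inner_diff_right algebra_simps flip: matrix_vector_mul_assoc)
  moreover have "real (Suc n) * u - (real (Suc n))\<^sup>2 * u\<^sup>2 * ?r / 2 \<le> h * (1 - u * ?r) + u"
  proof -
    have "(real n * u - (real n)\<^sup>2 * u\<^sup>2 * ?r / 2) * (1 - u * ?r) + u \<le> h * (1 - u * ?r) + u"
      using h(1) assms(2) by (simp add: mult_right_mono)
    moreover have "(real n * u - (real n)\<^sup>2 * u\<^sup>2 * ?r / 2) * (1 - u * ?r) + u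
       = real (Suc n) * u - (real (Suc n))\<^sup>2 * u\<^sup>2 * ?r / 2 + (u\<^sup>2 * ?r / 2 + (real n)\<^sup>2 * u * u\<^sup>2 * ?r\<^sup>2 / 2)"
      by (simp add: field_simps power2_eq_square)
    moreover have "0 \<le> u\<^sup>2 * ?r / 2 + (real n)\<^sup>2 * u * u\<^sup>2 * ?r\<^sup>2 / 2"
      using assms(1) by simp
    ultimately show ?thesis by linarith
  qed
  ultimately show ?case by blast
qed

text \<open>Cyclicity moves one \<open>Q\<close> to the other side of \<open>W\<close>. Estimates
  that hold vector by vector can then be applied to traces.\<close>

lemma trace_symmetric_sandwich:
  fixes Q W :: "real^'n^'n"
  assumes "transpose Q = Q"
  shows "trace (Q ** Q ** W) = (\<Sum>i\<in>UNIV. Q $ i \<bullet> (W *v Q $ i))"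
proof -
  have "transpose Q $ j $ i = Q $ j $ i" for i j by (simp only: assms)
  then have Q: "Q $ i $ j = Q $ j $ i" for i j by (simp add: transpose_def)
  have "trace (Q ** Q ** W) = trace (Q ** (Q ** W))" by (simp only: matrix_mul_assoc)
  also have "\<dots> = trace ((Q ** W) ** Q)" by (rule trace_mul_sym)
  also have "\<dots> = trace (Q ** (W ** Q))" by (simp only: matrix_mul_assoc)
  also have "\<dots> = (\<Sum>i\<in>UNIV. Q $ i \<bullet> (W *v Q $ i))"
    unfolding trace_def matrix_matrix_mult_def inner_vec_def matrix_vector_mult_def
    by (subst (2) Q) simp
  finally show ?thesis .
qed

lemma pexp_even: "pexp (2 * M) A =
    mpow (mat 1 + (1 / real (2 * M)) *\<^sub>R A) M ** mpow (mat 1 + (1 / real (2 * M)) *\<^sub>R A) M"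
  unfolding pexp_def by (simp only: mult_2 mpow_add)

text \<open>An even exponent makes \<open>pexp\<close> the square of the symmetric matrix
  \<open>Q M\<close>, which plays the part of exp(A/2).\<close>

lemma trace_pexp_even:
  fixes A :: "real^'n^'n"
  assumes "transpose A = A"
  defines "Q \<equiv> \<lambda>M. mpow (mat 1 + (1 / real (2 * M)) *\<^sub>R A) M"
  shows "trace (pexp (2 * M) A) = (\<Sum>i\<in>UNIV. Q M $ i \<bullet> Q M $ i)"
    and "trace (pexp (2 * M) A ** W) = (\<Sum>i\<in>UNIV. Q M $ i \<bullet> (W *v Q M $ i))"
proof -
  have "transpose (Q M) = Q M"
    unfolding Q_def transpose_mpow transpose_pexp_base[OF assms(1)] ..
  from trace_symmetric_sandwich[OF this]
  have *: "trace (pexp (2 * M) A ** W) = (\<Sum>i\<in>UNIV. Q M $ i \<bullet> (W *v Q M $ i))" for W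
    by (simp only: pexp_even Q_def)
  show "trace (pexp (2 * M) A ** W) = (\<Sum>i\<in>UNIV. Q M $ i \<bullet> (W *v Q M $ i))" by (rule *)
  show "trace (pexp (2 * M) A) = (\<Sum>i\<in>UNIV. Q M $ i \<bullet> Q M $ i)"
    using *[of "mat 1"] by simp
qed

text \<open>The trace is the squared Frobenius norm of the half power \<open>Q\<close>, which
  dominates the squared norm of \<open>Q *v w\<close> for a unit vector \<open>w\<close>.\<close>

lemma trace_pexp_ge_eigenvalue:
  fixes A :: "real^'n^'n"
  assumes sym: "transpose A = A" and w: "norm w = 1" "A *v w = c *\<^sub>R w"
  shows "(1 + c / real (2 * M)) ^ (2 * M) \<le> trace (pexp (2 * M) A)"
proof -
  define P where "P = mat 1 + (1 / real (2 * M)) *\<^sub>R A"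
  define Q where "Q = mpow P M"
  have P: "P *v w = (1 + c / real (2 * M)) *\<^sub>R w"
    by (simp add: P_def matrix_vector_mult_add_rdistrib scaleR_matrix_vector_assoc[symmetric] w algebra_simps)
  have "mpow P n *v w = (1 + c / real (2 * M)) ^ n *\<^sub>R w" for n
    by (induction n) (simp_all add: P matrix_vector_mult_scaleR mult.commute flip: matrix_vector_mul_assoc)
  then have "(1 + c / real (2 * M)) ^ (2 * M) = (norm (Q *v w))\<^sup>2"
    by (simp add: Q_def w power_even_eq)
  also have "\<dots> = (\<Sum>i\<in>UNIV. (Q $ i \<bullet> w)\<^sup>2)"
    unfolding power2_norm_eq_inner
    by (simp add: inner_vec_def matrix_vector_mult_def power2_eq_square)
  also have "\<dots> \<le> (\<Sum>i\<in>UNIV. Q $ i \<bullet> Q $ i)"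
  proof (rule sum_mono)
    fix i
    show "(Q $ i \<bullet> w)\<^sup>2 \<le> Q $ i \<bullet> Q $ i"
      using Cauchy_Schwarz_ineq[of "Q $ i" w] w by (simp add: norm_eq_1)
  qed
  also have "\<dots> = trace (pexp (2 * M) A)"
    unfolding trace_pexp_even(1)[OF sym] Q_def P_def ..
  finally show ?thesis .
qed

text \<open>\<open>trace_pexp_add_le\<close> splits off the rank-one part, whose power is explicit
  by \<open>mpow_outer\<close>. The main term is quadratic in \<open>x\<close>, so its mean involves
  second moments only. The parameter \<open>g\<close> is left free so that one value can serve all
  \<open>x\<close>; \<open>b\<close> enters the error term only.\<close>

lemma trace_pexp_minus_outer_le:
  fixes A :: "real^'n^'n"
  assumes sym: "transpose A = A" and bd: "mbound A a" "0 \<le> a" "x \<bullet> x \<le> b"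
    and \<theta>: "0 \<le> \<theta>" "\<theta> * (x \<bullet> x) \<le> 1" and g: "g \<le> \<theta> - \<theta>\<^sup>2 * (x \<bullet> x) / 2"
    and N: "N = 2 * M" "M = 2 ^ n"
  defines "q \<equiv> \<lambda>i. mpow (mat 1 + (1 / real N) *\<^sub>R A) M $ i"
  shows "trace (pexp N (A - \<theta> *\<^sub>R outer x)) \<le> (\<Sum>i\<in>UNIV. q i \<bullet> q i - g * (x \<bullet> q i)\<^sup>2)
     + real CARD('n) * a * (\<theta> * b) * exp (a + \<theta> * b) / real N"
proof -
  let ?W = "pexp N (- \<theta> *\<^sub>R outer x)"
  have "N > 0" by (simp add: N)
  then have Npos: "real N \<ge> 1" by linarith
  have b: "0 \<le> b" using bd(3) inner_ge_zero[of x] by linarith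
  have "mbound (- \<theta> *\<^sub>R outer x) (\<theta> * b)"
    unfolding mbound_def
  proof
    fix v
    have "norm (outer x *v v) \<le> b * norm v"
      using mboundD[OF mbound_outer, of x v] bd(3)
      by (meson mult_right_mono norm_ge_zero order_trans)
    then show "norm ((- \<theta> *\<^sub>R outer x) *v v) \<le> \<theta> * b * norm v"
      using \<theta>(1) by (simp add: scaleR_matrix_vector_assoc[symmetric] mult_left_mono mult.assoc del: scaleR_minus_left)
  qed
  moreover have "transpose (- \<theta> *\<^sub>R outer x) = - \<theta> *\<^sub>R outer x"
    by (simp only: transpose_scalar transpose_outer)
  ultimately have "trace (pexp N (A + - \<theta> *\<^sub>R outer x)) \<le> trace (pexp N A ** ?W)
     + real CARD('n) * a * (\<theta> * b) * exp (a + \<theta> * b) / real N"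
    using sym bd(1,2) \<theta>(1) b by (intro trace_pexp_add_le[where n = "Suc n"]) (auto simp: N)
  also have "trace (pexp N A ** ?W) = (\<Sum>i\<in>UNIV. q i \<bullet> (?W *v q i))"
    unfolding q_def N(1) by (rule trace_pexp_even(2)[OF sym])
  also have "\<dots> \<le> (\<Sum>i\<in>UNIV. q i \<bullet> q i - g * (x \<bullet> q i)\<^sup>2)"
  proof (rule sum_mono)
    fix i
    have "\<theta> / real N * (x \<bullet> x) \<le> 1"
      using \<theta> Npos by (simp add: divide_le_eq)
    from mpow_outer[OF _ this, of N] \<theta>(1) obtain h where
      h: "real N * (\<theta> / real N) - (real N)\<^sup>2 * (\<theta> / real N)\<^sup>2 * (x \<bullet> x) / 2 \<le> h"
        "\<And>v. mpow (mat 1 - (\<theta> / real N) *\<^sub>R outer x) N *v v = v - (h * (x \<bullet> v)) *\<^sub>R x"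
      by auto
    \<comment> \<open>For \<open>u = \<theta> / N\<close> and exponent \<open>N\<close> the lower
      bound of \<open>mpow_outer\<close> is
      \<open>\<theta> - \<theta>\<^sup>2 * (x \<bullet> x) / 2\<close>, free of
      \<open>N\<close>.\<close>
    have "g \<le> h" using h(1) g Npos by (simp add: power_divide)
    have "?W = mpow (mat 1 - (\<theta> / real N) *\<^sub>R outer x) N"
      by (simp add: pexp_def)
    then have "q i \<bullet> (?W *v q i) = q i \<bullet> q i - h * (x \<bullet> q i)\<^sup>2"
      by (simp add: h(2) inner_diff_right power2_eq_square inner_commute)
    also have "\<dots> \<le> q i \<bullet> q i - g * (x \<bullet> q i)\<^sup>2"
      using \<open>g \<le> h\<close> by (simp add: mult_right_mono)
    finally show "q i \<bullet> (?W *v q i) \<le> q i \<bullet> q i - g * (x \<bullet> q i)\<^sup>2" .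
  qed
  finally show ?thesis by simp
qed

subsection \<open>A lower-tail matrix Chernoff bound\<close>

lemma mbound_mono: "mbound A a \<Longrightarrow> a \<le> b \<Longrightarrow> mbound A b"
  unfolding mbound_def by (meson mult_right_mono norm_ge_zero order_trans)

lemma mbound_sum:
  assumes "finite I" "\<And>i. i \<in> I \<Longrightarrow> mbound (A i) b"
  shows "mbound (\<Sum>i\<in>I. A i) (real (card I) * b)"
  using assms
proof (induction I rule: finite_induct)
  case empty
  then show ?case by (simp add: mbound_def)
next
  case (insert i I)
  then have "mbound (A i + (\<Sum>i\<in>I. A i)) (b + real (card I) * b)"
    by (intro mbound_add) auto
  with insert show ?case by (simp add: algebra_simps)
qed

lemma mbound_scaleR: "mbound A a \<Longrightarrow> mbound (c *\<^sub>R A) (\<bar>c\<bar> * a)"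
  unfolding mbound_def
  by (simp add: scaleR_matrix_vector_assoc[symmetric] mult_left_mono mult.assoc)

lemma trace_pexp_nonneg:
  assumes "transpose A = A"
  shows "0 \<le> trace (pexp (2 * M) A)"
  unfolding trace_pexp_even(1)[OF assms] by (intro sum_nonneg) simp

section \<open>Measurability of traces and of the small-eigenvalue event\<close>

lemma borel_measurable_mpow:
  fixes F :: "'a \<Rightarrow> real^'n^'n"
  assumes [measurable]: "\<And>i j. (\<lambda>x. F x $ i $ j) \<in> borel_measurable M"
  shows "(\<lambda>x. mpow (F x) n $ i $ j) \<in> borel_measurable M"
proof (induction n arbitrary: i j)
  case 0
  then show ?case by simp
next
  case (Suc n)
  note [measurable] = Suc
  show ?case by (simp add: matrix_matrix_mult_def)
qed

lemma borel_measurable_trace_pexp: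
  fixes F :: "'a \<Rightarrow> real^'n^'n"
  assumes [measurable]: "\<And>i j. (\<lambda>x. F x $ i $ j) \<in> borel_measurable M"
  shows "(\<lambda>x. trace (pexp N (F x))) \<in> borel_measurable M"
  unfolding trace_def pexp_def by (intro borel_measurable_sum borel_measurable_mpow) simp

lemma borel_measurable_matrix:
  fixes F :: "'a \<Rightarrow> real^'n^'m"
  assumes "\<And>i j. (\<lambda>x. F x $ i $ j) \<in> borel_measurable M"
  shows "F \<in> borel_measurable M"
  by (subst borel_measurable_euclidean_space) (auto simp: Basis_vec_def inner_axis assms)

text \<open>The event is an uncountable union over unit vectors, but a union of open sets; openness
  therefore provides its measurability.\<close>

lemma open_Rayleigh_less: "open {B :: real^'n^'n. \<exists>v. norm v = 1 \<and> v \<bullet> (B *v v) < s}"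
proof -
  have "open {B :: real^'n^'n. v \<bullet> (B *v v) < s}" for v
    unfolding matrix_vector_mult_def inner_vec_def
    by (intro open_Collect_less continuous_intros)
  then have "open (\<Union>v\<in>sphere 0 1. {B :: real^'n^'n. v \<bullet> (B *v v) < s})" by blast
  moreover have "(\<Union>v\<in>sphere 0 1. {B. v \<bullet> (B *v v) < s}) = {B :: real^'n^'n. \<exists>v. norm v = 1 \<and> v \<bullet> (B *v v) < s}"
    by auto
  ultimately show ?thesis by simp
qed

section \<open>Exponential moments of random Gram matrices\<close>

definition gram :: "'i set \<Rightarrow> ('i \<Rightarrow> real^'n) \<Rightarrow> real^'n^'n" where
  "gram I x = (\<Sum>i\<in>I. outer (x i))"

lemma transpose_gram [simp]: "transpose (gram I x) = gram I x"
  by (simp add: gram_def transpose_sum)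

text \<open>Two bounds are kept apart. The almost sure bound \<open>m\<close>, which is what a
  supremum over the support provides, determines the rate. The pointwise bound \<open>b\<close>
  serves integrability and the error terms that vanish as \<open>N\<close> grows.\<close>

locale bounded_feature_map = prob_space M for M :: "'a measure" +
  fixes f :: "'a \<Rightarrow> real^'k" and lam m b :: real
  assumes f_measurable [measurable]: "\<And>k. (\<lambda>x. f x $ k) \<in> borel_measurable M"
    and f_bounded: "\<And>x. f x \<bullet> f x \<le> b"
    and f_AE_bounded: "AE x in M. f x \<bullet> f x \<le> m"
    and second_moment_ge: "\<And>v. lam * (v \<bullet> v) \<le> (\<integral>x. (f x \<bullet> v)\<^sup>2 \<partial>M)"
    and lam_pos: "0 < lam" and m_pos: "0 < m"
begin

lemma inner_f_measurable [measurable]: "(\<lambda>x. f x \<bullet> v) \<in> borel_measurable M"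
  unfolding inner_vec_def by simp

lemma b_nonneg: "0 \<le> b"
  using f_bounded inner_ge_zero order_trans by blast

lemma integrable_inner_f_square: "integrable M (\<lambda>x. (f x \<bullet> v)\<^sup>2)"
proof (rule integrable_const_bound)
  show "AE x in M. norm ((f x \<bullet> v)\<^sup>2) \<le> b * (v \<bullet> v)"
  proof (rule AE_I2)
    fix x
    have "(f x \<bullet> v)\<^sup>2 \<le> (f x \<bullet> f x) * (v \<bullet> v)" by (rule Cauchy_Schwarz_ineq)
    also have "\<dots> \<le> b * (v \<bullet> v)" by (intro mult_right_mono f_bounded) simp
    finally show "norm ((f x \<bullet> v)\<^sup>2) \<le> b * (v \<bullet> v)" by simp
  qed
qed measurable

text \<open>At each row \<open>q i\<close> the mean of the quadratic bound is at most
  \<open>(1 - g * lam) * (q i \<bullet> q i)\<close>, and 1 - t \<le> exp(-t). Summing over rows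
  restores the trace of \<open>pexp N A\<close>, so one summand contributes a fixed factor up to an
  O(1/N) error.\<close>

lemma nn_integral_trace_pexp_step:
  assumes sym: "transpose A = A" and bd: "mbound A a" "0 \<le> a"
    and \<theta>: "0 \<le> \<theta>" "\<theta> * m \<le> 1" and N: "N = 2 * 2 ^ n"
  shows "(\<integral>\<^sup>+ x. ennreal (trace (pexp N (A - \<theta> *\<^sub>R outer (f x)))) \<partial>M)
     \<le> ennreal (exp (- ((\<theta> - \<theta>\<^sup>2 * m / 2) * lam)) * trace (pexp N A)
                + real CARD('k) * a * (\<theta> * b) * exp (a + \<theta> * b) / real N)"
proof -
  define g where "g = \<theta> - \<theta>\<^sup>2 * m / 2"
  define D where "D = real CARD('k) * a * (\<theta> * b) * exp (a + \<theta> * b) / real N"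
  define q where "q i = mpow (mat 1 + (1 / real N) *\<^sub>R A) (2 ^ n) $ i" for i
  define h where "h x = (\<Sum>i\<in>UNIV. q i \<bullet> q i - g * (f x \<bullet> q i)\<^sup>2) + D" for x
  have trA: "trace (pexp N A) = (\<Sum>i\<in>UNIV. q i \<bullet> q i)"
    unfolding N q_def by (rule trace_pexp_even(1)[OF sym])
  \<comment> \<open>\<open>\<theta> * m \<le> 1\<close> keeps \<open>g\<close> nonnegative, so that
    \<open>second_moment_ge\<close> may be multiplied by it.\<close>
  have g_nonneg: "0 \<le> g"
  proof -
    have "\<theta> * (\<theta> * m) \<le> \<theta> * 1" using \<theta> by (intro mult_left_mono)
    then show ?thesis using \<theta>(1) by (simp add: g_def power2_eq_square)
  qed
  have le: "AE x in M. trace (pexp N (A - \<theta> *\<^sub>R outer (f x))) \<le> h x"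
    using f_AE_bounded
  proof (rule AE_mp, intro AE_I2 impI)
    fix x assume x: "f x \<bullet> f x \<le> m"
    have "\<theta> * (f x \<bullet> f x) \<le> 1"
      using mult_left_mono[OF x \<theta>(1)] \<theta>(2) by linarith
    moreover have "g \<le> \<theta> - \<theta>\<^sup>2 * (f x \<bullet> f x) / 2"
      using mult_left_mono[OF x, of "\<theta>\<^sup>2"] by (simp add: g_def)
    ultimately show "trace (pexp N (A - \<theta> *\<^sub>R outer (f x))) \<le> h x"
      unfolding h_def q_def D_def
      using trace_pexp_minus_outer_le[OF sym bd f_bounded \<theta>(1) _ _ N refl] by simp
  qed
  have nonneg: "0 \<le> trace (pexp N (A - \<theta> *\<^sub>R outer (f x)))" for x
  proof -
    have "transpose (A + (- \<theta>) *\<^sub>R outer (f x)) = A + (- \<theta>) *\<^sub>R outer (f x)"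
      by (simp only: transpose_add transpose_scalar sym transpose_outer)
    from trace_pexp_nonneg[OF this, of "2 ^ n"] show ?thesis by (simp add: N)
  qed
  have int: "integrable M h"
    unfolding h_def by (simp add: integrable_inner_f_square)
  have "(\<integral>\<^sup>+ x. ennreal (trace (pexp N (A - \<theta> *\<^sub>R outer (f x)))) \<partial>M) \<le> (\<integral>\<^sup>+ x. ennreal (h x) \<partial>M)"
    by (rule nn_integral_mono_AE) (use le in \<open>auto elim!: eventually_mono intro: ennreal_leI\<close>)
  also have "\<dots> = ennreal (\<integral>x. h x \<partial>M)"
    by (rule nn_integral_eq_integral[OF int])
      (use le in \<open>auto elim!: eventually_mono intro: order_trans[OF nonneg]\<close>)
  also have "\<dots> \<le> ennreal (exp (- (g * lam)) * trace (pexp N A) + D)"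
  proof (rule ennreal_leI)
    have "(\<integral>x. h x \<partial>M) = (\<Sum>i\<in>UNIV. q i \<bullet> q i - g * (\<integral>x. (f x \<bullet> q i)\<^sup>2 \<partial>M)) + D"
      unfolding h_def by (simp add: integrable_inner_f_square prob_space)
    also have "(\<Sum>i\<in>UNIV. q i \<bullet> q i - g * (\<integral>x. (f x \<bullet> q i)\<^sup>2 \<partial>M))
        \<le> (\<Sum>i\<in>UNIV. exp (- (g * lam)) * (q i \<bullet> q i))"
    proof (rule sum_mono)
      fix i
      have "q i \<bullet> q i - g * (\<integral>x. (f x \<bullet> q i)\<^sup>2 \<partial>M) \<le> q i \<bullet> q i - g * (lam * (q i \<bullet> q i))"
        using mult_left_mono[OF second_moment_ge g_nonneg] by simp
      also have "\<dots> = (1 + - (g * lam)) * (q i \<bullet> q i)" by (simp add: algebra_simps)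
      also have "\<dots> \<le> exp (- (g * lam)) * (q i \<bullet> q i)"
        by (intro mult_right_mono exp_ge_add_one_self) simp
      finally show "q i \<bullet> q i - g * (\<integral>x. (f x \<bullet> q i)\<^sup>2 \<partial>M) \<le> exp (- (g * lam)) * (q i \<bullet> q i)" .
    qed
    finally show "(\<integral>x. h x \<partial>M) \<le> exp (- (g * lam)) * trace (pexp N A) + D"
      by (simp add: trA sum_distrib_left)
  qed
  finally show ?thesis by (simp add: g_def D_def)
qed

lemma borel_measurable_gram:
  assumes "finite I"
  shows "(\<lambda>xs. gram I (\<lambda>i. f (xs i)) $ j $ k) \<in> borel_measurable (Pi\<^sub>M I (\<lambda>_. M))"
proof -
  have "(\<lambda>xs. f (xs i) $ k) \<in> borel_measurable (Pi\<^sub>M I (\<lambda>_. M))" if "i \<in> I" for i k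
    using measurable_compose[OF measurable_component_singleton[OF that] f_measurable] .
  then show ?thesis
    by (simp add: gram_def outer_def)
qed

lemma mbound_gram:
  assumes "finite I"
  shows "mbound (gram I (\<lambda>i. f (xs i))) (real (card I) * b)"
  unfolding gram_def using assms mbound_mono[OF mbound_outer f_bounded] by (rule mbound_sum)

text \<open>Fubini integrates out one coordinate at a time, the Gram matrix of the others acting as
  the fixed \<open>A\<close> of the one-step bound. \<open>C\<close> is formed with \<open>L\<close>
  instead of the current cardinality so that it stays constant through the induction.\<close>

lemma nn_integral_trace_pexp_gram:
  fixes I :: "'i set"
  assumes \<theta>: "0 \<le> \<theta>" "\<theta> * m \<le> 1" and N: "N = 2 * 2 ^ n"
    and I: "finite I" "card I \<le> L"
  defines "C \<equiv> real CARD('k) * (\<theta> * (real L * b)) * (\<theta> * b) * exp (\<theta> * (real L * b) + \<theta> * b) / real N"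
  shows "(\<integral>\<^sup>+ xs. ennreal (trace (pexp N (- \<theta> *\<^sub>R gram I (\<lambda>i. f (xs i))))) \<partial>Pi\<^sub>M I (\<lambda>_. M))
     \<le> ennreal (real CARD('k) * exp (- ((\<theta> - \<theta>\<^sup>2 * m / 2) * lam)) ^ card I + real (card I) * C)"
  using I
proof (induction I rule: finite_induct)
  case empty
  interpret product_sigma_finite "\<lambda>_::'i. M" by standard
  have "trace (pexp N (0 :: real^'k^'k)) = real CARD('k)"
  proof -
    have "mpow (mat 1 :: real^'k^'k) n = mat 1" for n by (induction n) simp_all
    then show ?thesis by (simp add: pexp_def trace_I)
  qed
  then show ?case by (simp add: gram_def PiM_empty)
next
  case (insert i I)
  interpret product_sigma_finite "\<lambda>_::'i. M" by standard
  let ?P = "Pi\<^sub>M I (\<lambda>_. M)"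
  let ?c = "exp (- ((\<theta> - \<theta>\<^sup>2 * m / 2) * lam))"
  let ?F = "\<lambda>I xs. trace (pexp N (- \<theta> *\<^sub>R gram I (\<lambda>i. f (xs i))))"
  have meas: "(\<lambda>xs. ?F J xs) \<in> borel_measurable (Pi\<^sub>M J (\<lambda>_. M))" if "finite J" for J
    by (intro borel_measurable_trace_pexp)
      (simp, intro borel_measurable_times borel_measurable_const borel_measurable_gram that)
  note [measurable] = meas[OF insert.hyps(1)]
  have C: "0 \<le> C" unfolding C_def using \<theta>(1) b_nonneg by simp
  \<comment> \<open>As the factor is at most 1, earlier errors do not grow and the total error is at
    most \<open>card I\<close> times \<open>C\<close>.\<close>
  have c1: "?c \<le> 1"
  proof -
    have "\<theta> * (\<theta> * m) \<le> \<theta> * 1" using \<theta> by (intro mult_left_mono)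
    then have "0 \<le> (\<theta> - \<theta>\<^sup>2 * m / 2) * lam"
      using \<theta>(1) lam_pos by (intro mult_nonneg_nonneg) (simp_all add: power2_eq_square)
    then show ?thesis by simp
  qed
  have sym: "transpose (- \<theta> *\<^sub>R gram I x) = - \<theta> *\<^sub>R gram I x" for x :: "'i \<Rightarrow> real^'k"
    by (simp only: transpose_scalar transpose_gram)
  have nonneg: "0 \<le> ?F I xs" for xs
    unfolding N by (rule trace_pexp_nonneg[OF sym])
  have "(\<integral>\<^sup>+ xs. ennreal (?F (insert i I) xs) \<partial>Pi\<^sub>M (insert i I) (\<lambda>_. M))
      = (\<integral>\<^sup>+ xs. (\<integral>\<^sup>+ x. ennreal (?F (insert i I) (xs(i := x))) \<partial>M) \<partial>?P)"
    by (rule product_nn_integral_insert[OF insert.hyps measurable_compose[OF meas measurable_ennreal]])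
      (simp add: insert.hyps)
  also have "\<dots> \<le> (\<integral>\<^sup>+ xs. ennreal (?c * ?F I xs + C) \<partial>?P)"
  proof (rule nn_integral_mono)
    fix xs
    let ?A = "- \<theta> *\<^sub>R gram I (\<lambda>i. f (xs i))"
    have "mbound ?A (\<bar>- \<theta>\<bar> * (real (card I) * b))"
      by (intro mbound_scaleR mbound_gram insert.hyps)
    moreover have "\<bar>- \<theta>\<bar> * (real (card I) * b) \<le> \<theta> * (real L * b)"
      using insert \<theta>(1) b_nonneg by (simp add: mult_left_mono mult_right_mono)
    ultimately have "mbound ?A (\<theta> * (real L * b))" by (rule mbound_mono)
    from nn_integral_trace_pexp_step[OF sym this _ \<theta> N]
    have "(\<integral>\<^sup>+ x. ennreal (trace (pexp N (?A - \<theta> *\<^sub>R outer (f x)))) \<partial>M) \<le> ennreal (?c * ?F I xs + C)"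
      using \<theta>(1) b_nonneg by (simp add: C_def)
    moreover have "- \<theta> *\<^sub>R gram (insert i I) (\<lambda>j. f ((xs(i := x)) j)) = ?A - \<theta> *\<^sub>R outer (f x)" for x
    proof -
      have "(\<Sum>j\<in>I. outer (f ((xs(i := x)) j))) = (\<Sum>j\<in>I. outer (f (xs j)))"
        using insert.hyps by (intro sum.cong) auto
      then show ?thesis using insert.hyps by (simp add: gram_def scaleR_add_right)
    qed
    ultimately show "(\<integral>\<^sup>+ x. ennreal (?F (insert i I) (xs(i := x))) \<partial>M) \<le> ennreal (?c * ?F I xs + C)"
      by (simp only:)
  qed
  also have "\<dots> = (\<integral>\<^sup>+ xs. ennreal ?c * ennreal (?F I xs) + ennreal C \<partial>?P)"
    using C nonneg by (intro nn_integral_cong) (simp only: ennreal_plus mult_nonneg_nonneg exp_ge_zero ennreal_mult)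
  also have "\<dots> = ennreal ?c * (\<integral>\<^sup>+ xs. ennreal (?F I xs) \<partial>?P) + ennreal C"
  proof -
    have "emeasure ?P (space ?P) = 1"
      by (intro prob_space.emeasure_space_1 prob_space_PiM) unfold_locales
    moreover have F: "(\<lambda>xs. ennreal (?F I xs)) \<in> borel_measurable ?P"
      by (rule measurable_compose[OF meas measurable_ennreal]) (rule insert.hyps)
    moreover have "(\<lambda>xs. ennreal ?c * ennreal (?F I xs)) \<in> borel_measurable ?P"
      using F by (rule borel_measurable_times_ennreal[OF borel_measurable_const])
    ultimately show ?thesis
      by (simp only: nn_integral_add borel_measurable_const nn_integral_cmult nn_integral_const mult_1_right)
  qed
  also have "\<dots> \<le> ennreal ?c * ennreal (real CARD('k) * ?c ^ card I + real (card I) * C) + ennreal C"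
    using insert by (intro add_right_mono mult_left_mono) auto
  also have "\<dots> = ennreal (?c * (real CARD('k) * ?c ^ card I + real (card I) * C) + C)"
    using C by (simp add: ennreal_mult ennreal_plus)
  also have "\<dots> \<le> ennreal (real CARD('k) * ?c ^ card (insert i I) + real (card (insert i I)) * C)"
  proof (rule ennreal_leI)
    have "?c * (real (card I) * C) \<le> 1 * (real (card I) * C)"
      using c1 C by (intro mult_right_mono) auto
    then show "?c * (real CARD('k) * ?c ^ card I + real (card I) * C) + C
        \<le> real CARD('k) * ?c ^ card (insert i I) + real (card (insert i I)) * C"
      using insert.hyps by (simp add: algebra_simps)
  qed
  finally show ?case .
qed

text \<open>Markov's inequality for the trace of \<open>pexp\<close>: on \<open>E\<close> the
  smallest eigenvalue is at most the threshold, which forces the trace to be large. Letting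
  \<open>N\<close> grow removes the error and turns powers into exponentials.\<close>

lemma prob_gram_small:
  fixes \<epsilon> :: real
  defines "P \<equiv> Pi\<^sub>M (UNIV :: 'l::finite set) (\<lambda>_. M)"
  defines "E \<equiv> {xs \<in> space P. \<exists>v. norm v = 1 \<and> v \<bullet> (gram UNIV (\<lambda>l. f (xs l)) *v v) < real CARD('l) * ((1 - \<epsilon>) * lam)}"
  assumes \<epsilon>: "0 < \<epsilon>" "\<epsilon> < 1"
  shows "E \<in> sets P"
    and "measure P E \<le> real CARD('k) * exp (- (\<epsilon>\<^sup>2 * real CARD('l) * lam / (2 * m)))"
proof -
  interpret P: prob_space P unfolding P_def by (intro prob_space_PiM) unfold_locales
  let ?G = "\<lambda>xs. gram UNIV (\<lambda>l. f (xs (l::'l)))"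
  define s where "s = real CARD('l) * ((1 - \<epsilon>) * lam)"
  have "?G \<in> borel_measurable P"
    unfolding P_def by (intro borel_measurable_matrix borel_measurable_gram) simp
  from measurable_sets[OF this borel_open[OF open_Rayleigh_less[of s]]] show E: "E \<in> sets P"
    unfolding E_def s_def by (simp add: vimage_def Int_def conj_commute)
  \<comment> \<open>This value minimises \<open>\<theta> * s - L * (\<theta> - \<theta>\<^sup>2 * m
    / 2) * lam\<close>, where \<open>L\<close> is the sample size; the minimum is the exponent in
    the claim.\<close>
  define \<theta> where "\<theta> = \<epsilon> / m"
  have \<theta>: "0 \<le> \<theta>" "\<theta> * m \<le> 1" using \<epsilon> m_pos by (simp_all add: \<theta>_def)
  have s: "0 \<le> s" using \<epsilon> lam_pos by (simp add: s_def)
  let ?L = "CARD('l)"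
  define c where "c = exp (- ((\<theta> - \<theta>\<^sup>2 * m / 2) * lam))"
  define C where "C = real CARD('k) * (\<theta> * (real ?L * b)) * (\<theta> * b) * exp (\<theta> * (real ?L * b) + \<theta> * b)"
  \<comment> \<open>Markov's inequality at a fixed \<open>N\<close>; \<open>big\<close> makes the
    base nonnegative, so that its power is monotone.\<close>
  have bound: "(1 + - (\<theta> * s) / real N) ^ N * measure P E \<le> real CARD('k) * c ^ ?L + real ?L * (C / real N)"
    if N: "N = 2 * 2 ^ n" and big: "\<theta> * s \<le> real N" for N n
  proof -
    let ?F = "\<lambda>xs. trace (pexp N (- \<theta> *\<^sub>R ?G xs))"
    let ?a = "(1 + - (\<theta> * s) / real N) ^ N"
    have "N > 0" by (simp add: N)
    then have base: "0 \<le> 1 + - (\<theta> * s) / real N" using big by (simp add: field_simps)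
    have sym: "transpose (- \<theta> *\<^sub>R ?G xs) = - \<theta> *\<^sub>R ?G xs" for xs
      by (simp only: transpose_scalar transpose_gram)
    have "ennreal ?a * emeasure P E = (\<integral>\<^sup>+ xs. ennreal ?a * indicator E xs \<partial>P)"
      using E by (simp add: nn_integral_cmult_indicator)
    also have "\<dots> \<le> (\<integral>\<^sup>+ xs. ennreal (?F xs) \<partial>P)"
    proof (rule nn_integral_mono)
      fix xs
      show "ennreal ?a * indicator E xs \<le> ennreal (?F xs)"
      proof (cases "xs \<in> E")
        case True
        then obtain v where v: "norm v = 1" "v \<bullet> (?G xs *v v) < s"
          unfolding E_def s_def by blast
        obtain e w where w: "norm w = 1" "?G xs *v w = e *\<^sub>R w" "\<And>w. e * (w \<bullet> w) \<le> w \<bullet> (?G xs *v w)"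
          using symmetric_min_eigenvector[OF transpose_gram] by blast
        have "e \<le> s" using w(3)[of v] v by (simp add: norm_eq_1)
        have "(- \<theta> *\<^sub>R ?G xs) *v w = (- \<theta> * e) *\<^sub>R w"
          by (simp only: scaleR_matrix_vector_assoc[symmetric] w scaleR_scaleR)
        from trace_pexp_ge_eigenvalue[OF sym w(1) this, of "2 ^ n"]
        have "(1 + (- \<theta> * e) / real N) ^ N \<le> ?F xs" by (simp only: N)
        moreover have "?a \<le> (1 + (- \<theta> * e) / real N) ^ N"
        proof (rule power_mono[OF _ base])
          have "\<theta> * e \<le> \<theta> * s" using \<open>e \<le> s\<close> \<theta>(1) by (rule mult_left_mono)
          then show "1 + - (\<theta> * s) / real N \<le> 1 + (- \<theta> * e) / real N"
            using \<open>N > 0\<close> by (simp add: divide_right_mono)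
        qed
        ultimately show ?thesis using True by (simp add: ennreal_leI)
      qed simp
    qed
    also have "\<dots> \<le> ennreal (real CARD('k) * c ^ ?L + real ?L * (C / real N))"
      unfolding P_def c_def C_def
      using nn_integral_trace_pexp_gram[OF \<theta> N, of "UNIV :: 'l set" ?L] by simp
    finally have "ennreal (?a * measure P E) \<le> ennreal (real CARD('k) * c ^ ?L + real ?L * (C / real N))"
      using base by (simp add: P.emeasure_eq_measure ennreal_mult)
    moreover have "0 \<le> C" using \<theta>(1) b_nonneg by (simp add: C_def)
    moreover have "0 \<le> c" by (simp add: c_def)
    ultimately show ?thesis by (subst (asm) ennreal_le_iff) auto
  qed
  \<comment> \<open>These exponents have the form \<open>2 * 2 ^ n\<close> demanded by
    \<open>bound\<close>: even for the square root, a power of two for the trace inequality.\<close>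
  let ?N = "\<lambda>n::nat. 2 ^ Suc n :: nat"
  have sub: "strict_mono ?N" by (rule strict_monoI) simp
  have "(\<lambda>n. (1 + - (\<theta> * s) / real (?N n)) ^ (?N n) * measure P E) \<longlonglongrightarrow> exp (- (\<theta> * s)) * measure P E"
    using LIMSEQ_subseq_LIMSEQ[OF tendsto_exp_limit_sequentially[of "- (\<theta> * s)"] sub]
    by (intro tendsto_mult_right) (simp only: comp_def)
  moreover have "(\<lambda>n. real CARD('k) * c ^ ?L + real ?L * (C / real (?N n))) \<longlonglongrightarrow> real CARD('k) * c ^ ?L + real ?L * 0"
    using LIMSEQ_subseq_LIMSEQ[OF lim_const_over_n[of C] sub]
    by (intro tendsto_add tendsto_mult_left tendsto_const) (simp only: comp_def)
  moreover have "\<forall>\<^sub>F n in sequentially. (1 + - (\<theta> * s) / real (?N n)) ^ (?N n) * measure P E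
      \<le> real CARD('k) * c ^ ?L + real ?L * (C / real (?N n))"
  proof -
    have "\<forall>\<^sub>F n in sequentially. \<theta> * s \<le> real n"
      using filterlim_real_sequentially unfolding filterlim_at_top by blast
    from eventually_subseq[OF sub this] show ?thesis
      by eventually_elim (rule bound, simp_all)
  qed
  ultimately have "exp (- (\<theta> * s)) * measure P E \<le> real CARD('k) * c ^ ?L"
    by (intro tendsto_le[OF sequentially_bot, rotated 1]) auto
  then have "exp (\<theta> * s) * (exp (- (\<theta> * s)) * measure P E) \<le> exp (\<theta> * s) * (real CARD('k) * c ^ ?L)"
    by (rule mult_left_mono) simp
  then have "measure P E \<le> real CARD('k) * (exp (\<theta> * s) * c ^ ?L)"
    by (simp add: exp_minus mult_ac)
  also have "exp (\<theta> * s) * c ^ ?L = exp (\<theta> * s - real ?L * ((\<theta> - \<theta>\<^sup>2 * m / 2) * lam))"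
    unfolding c_def exp_of_nat_mult[symmetric] by (simp add: exp_add[symmetric])
  also have "\<theta> * s - real ?L * ((\<theta> - \<theta>\<^sup>2 * m / 2) * lam) = - (\<epsilon>\<^sup>2 * real ?L * lam / (2 * m))"
    using m_pos by (simp add: \<theta>_def s_def field_simps power2_eq_square)
  finally show "measure P E \<le> real CARD('k) * exp (- (\<epsilon>\<^sup>2 * real CARD('l) * lam / (2 * m)))" .
qed

end

subsection \<open>Least squares and the pseudoinverse\<close>

text \<open>The complement of the support is a union of null balls, and by Lindelof countably many
  of them suffice.\<close>

lemma AE_in_msupp:
  fixes M :: "'d::{metric_space, second_countable_topology} measure"
  assumes "finite_measure M" "sets M = sets borel"
  shows "AE x in M. x \<in> msupp M"
proof -
  interpret finite_measure M by fact
  define F where "F = {ball x e | x e :: real. measure M (ball x e) = 0}"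
  obtain F' where F': "F' \<subseteq> F" "countable F'" "\<Union>F' = \<Union>F"
    by (rule Lindelof[of F]) (auto simp: F_def)
  have "S \<in> null_sets M" if "S \<in> F'" for S
    using that F'(1) assms(2) by (auto simp: F_def null_sets_def emeasure_eq_measure)
  then have "\<Union>F' \<in> null_sets M"
    using null_sets_UN'[OF F'(2), of "\<lambda>S. S" M] by simp
  then have "AE x in M. x \<notin> \<Union>F'" by (rule AE_not_in)
  then have "AE x in M. x \<notin> \<Union>F" by (simp only: F'(3))
  then show ?thesis
  proof (rule AE_mp, intro AE_I2 impI)
    fix x assume "x \<notin> \<Union>F"
    have "measure M (ball x e) \<noteq> 0" if "e > 0" for e :: real
    proof
      assume "measure M (ball x e) = 0"
      then have "ball x e \<in> F" unfolding F_def by blast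
      with \<open>x \<notin> \<Union>F\<close> that show False by fastforce
    qed
    then show "x \<in> msupp M" by (simp add: msupp_def zero_less_measure_iff)
  qed
qed

section \<open>Rayleigh bounds, smallest singular values and the pseudoinverse\<close>

lemma eigvalsI: "v \<noteq> 0 \<Longrightarrow> M *v v = c *\<^sub>R v \<Longrightarrow> c \<in> eigvals M"
  by (auto simp: eigvals_def)

lemma eigvals_nonempty:
  fixes M :: "real^'n^'n"
  assumes "transpose M = M"
  shows "eigvals M \<noteq> {}"
proof -
  obtain c v where v: "norm v = 1" "M *v v = c *\<^sub>R v"
    using symmetric_min_eigenvector[OF assms] by blast
  have "v \<noteq> 0" using v(1) by auto
  from eigvalsI[OF this v(2)] show ?thesis by blast
qed

lemma Rayleigh_ge:
  fixes M :: "real^'n^'n"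
  assumes sym: "transpose M = M" and lo: "\<And>c. c \<in> eigvals M \<Longrightarrow> lo \<le> c"
  shows "lo * (w \<bullet> w) \<le> w \<bullet> (M *v w)"
proof -
  obtain c v where v: "norm v = 1" "M *v v = c *\<^sub>R v" and le: "\<And>w. c * (w \<bullet> w) \<le> w \<bullet> (M *v w)"
    using symmetric_min_eigenvector[OF sym] by blast
  have "v \<noteq> 0" using v(1) by auto
  then have "c \<in> eigvals M" using v(2) by (rule eigvalsI)
  then have "lo * (w \<bullet> w) \<le> c * (w \<bullet> w)" by (simp add: lo mult_right_mono)
  with le show ?thesis by (rule order_trans[rotated])
qed

text \<open>\<open>Rayleigh_ge\<close> applied to \<open>- M\<close>, whose eigenvalues are the
  negatives.\<close>

lemma Rayleigh_le:
  fixes M :: "real^'n^'n"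
  assumes sym: "transpose M = M" and hi: "\<And>c. c \<in> eigvals M \<Longrightarrow> c \<le> hi"
  shows "w \<bullet> (M *v w) \<le> hi * (w \<bullet> w)"
proof -
  have neg: "(- M) *v v = - (M *v v)" for v
    by (simp add: vec_eq_iff matrix_vector_mult_def sum_negf)
  have "transpose (- M) = - M" using sym by (simp add: transpose_def vec_eq_iff)
  moreover have "- hi \<le> c" if c: "c \<in> eigvals (- M)" for c
  proof -
    obtain v where "v \<noteq> 0" "(- M) *v v = c *\<^sub>R v" using c unfolding eigvals_def by blast
    then have "M *v v = (- c) *\<^sub>R v" by (simp add: neg) (metis minus_minus)
    then have "- c \<in> eigvals M" using \<open>v \<noteq> 0\<close> unfolding eigvals_def by blast
    from hi[OF this] show ?thesis by simp
  qed
  ultimately have "- hi * (w \<bullet> w) \<le> w \<bullet> ((- M) *v w)" by (rule Rayleigh_ge)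
  then show ?thesis by (simp add: neg)
qed

lemma gram_eq_transpose_mult:
  "transpose (design_matrix \<eta> xs) ** design_matrix \<eta> xs = gram UNIV (\<lambda>l. \<eta> (xs l))"
  by (simp add: vec_eq_iff design_matrix_def gram_def outer_def matrix_matrix_mult_def transpose_def)

lemma norm_mult_eq_gram_quadratic:
  fixes A :: "real^'n^'m"
  shows "(norm (A *v w))\<^sup>2 = w \<bullet> ((transpose A ** A) *v w)"
proof -
  have "(A *v w) \<bullet> (A *v w) = (transpose A *v (A *v w)) \<bullet> w"
    by (simp only: dot_lmul_matrix transpose_matrix_vector)
  then show ?thesis
    by (simp only: power2_norm_eq_inner matrix_vector_mul_assoc inner_commute)
qed

lemma min_sing_sq_ge_imp:
  fixes A :: "real^'n^'m"
  assumes "t \<le> min_sing_sq A"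
  shows "t * (w \<bullet> w) \<le> (norm (A *v w))\<^sup>2"
  unfolding norm_mult_eq_gram_quadratic
proof (rule Rayleigh_ge)
  show sym: "transpose (transpose A ** A) = transpose A ** A"
    by (simp add: matrix_transpose_mul)
  show "t \<le> c" if "c \<in> eigvals (transpose A ** A)" for c
    using assms Min_le[OF finite_eigvals[OF sym] that] by (simp add: min_sing_sq_def)
qed

text \<open>A normalised eigenvector for the least eigenvalue is a witness. This puts a failed
  threshold test into the form of the event in \<open>prob_gram_small\<close>.\<close>

lemma min_sing_sq_less_imp:
  fixes A :: "real^'n^'m"
  assumes "min_sing_sq A < t"
  shows "\<exists>v. norm v = 1 \<and> v \<bullet> ((transpose A ** A) *v v) < t"
proof -
  let ?G = "transpose A ** A"
  have sym: "transpose ?G = ?G" by (simp add: matrix_transpose_mul)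
  have "min_sing_sq A \<in> eigvals ?G"
    unfolding min_sing_sq_def by (intro Min_in finite_eigvals eigvals_nonempty sym)
  then obtain v where v: "v \<noteq> 0" "?G *v v = min_sing_sq A *\<^sub>R v"
    unfolding eigvals_def by blast
  let ?u = "v /\<^sub>R norm v"
  have u: "norm ?u = 1" using v(1) by simp
  have "?G *v ?u = min_sing_sq A *\<^sub>R ?u"
    using v(2) by (simp only: matrix_vector_mult_scaleR scaleR_left_commute)
  moreover have "?u \<bullet> ?u = 1" using u by (simp only: norm_eq_1)
  ultimately have "?u \<bullet> (?G *v ?u) < t"
    using assms by (simp only: inner_scaleR_right mult_1_right)
  with u show ?thesis by blast
qed

text \<open>\<open>pinv\<close> is a definite description, so existence and uniqueness come first.
  Injectivity makes \<open>transpose A ** A\<close> invertible, and its inverse times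
  \<open>transpose A\<close> satisfies the Penrose equations.\<close>

lemma pinv_full_column_rank:
  fixes A :: "real^'k^'l"
  assumes inj: "inj ((*v) A)"
  shows "pinv A ** A = mat 1" and "transpose (A ** pinv A) = A ** pinv A"
proof -
  let ?penrose = "\<lambda>P. A ** P ** A = A \<and> P ** A ** P = P \<and>
                    transpose (A ** P) = A ** P \<and> transpose (P ** A) = P ** A"
  have left: "P ** A = mat 1" if "A ** P ** A = A" for P
  proof -
    have "A *v ((P ** A) *v w) = A *v w" for w
      by (simp only: matrix_vector_mul_assoc matrix_mul_assoc that)
    then have "(P ** A) *v w = w" for w using inj by (simp add: inj_def)
    then show ?thesis by (simp add: matrix_eq)
  qed
  have "\<exists>P. ?penrose P"
  proof -
    let ?G = "transpose A ** A"
    have "w = 0" if "?G *v w = 0" for w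
    proof -
      have "(norm (A *v w))\<^sup>2 = 0" by (simp only: norm_mult_eq_gram_quadratic that inner_zero_right)
      then have "A *v w = A *v 0" by simp
      then show ?thesis using inj by (simp only: inj_def)
    qed
    then obtain B where B: "B ** ?G = mat 1"
      using matrix_left_invertible_ker[of ?G] by blast
    have symG: "transpose ?G = ?G" by (simp add: matrix_transpose_mul)
    have GB: "?G ** transpose B = mat 1"
      using arg_cong[OF B, of transpose] symG by (simp add: matrix_transpose_mul)
    have "transpose B = (B ** ?G) ** transpose B" by (simp only: B matrix_mul_lid)
    also have "\<dots> = B ** (?G ** transpose B)" by (simp only: matrix_mul_assoc)
    finally have symB: "transpose B = B" by (simp only: GB matrix_mul_rid)
    have PA: "(B ** transpose A) ** A = mat 1" using B by (simp add: matrix_mul_assoc)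
    have "?penrose (B ** transpose A)"
    proof (intro conjI)
      have "A ** (B ** transpose A) ** A = A ** ((B ** transpose A) ** A)"
        by (simp only: matrix_mul_assoc)
      then show "A ** (B ** transpose A) ** A = A" by (simp only: PA matrix_mul_rid)
      show "transpose (A ** (B ** transpose A)) = A ** (B ** transpose A)"
        by (simp add: matrix_transpose_mul symB matrix_mul_assoc)
    qed (simp_all only: PA matrix_mul_lid transpose_mat)
    then show ?thesis by blast
  qed
  moreover have "P = Q" if P: "?penrose P" and Q: "?penrose Q" for P Q
  proof -
    \<comment> \<open>Left multiplication by \<open>A ** Q\<close> fixes \<open>A ** P\<close>.
      Transposing reverses the factors and yields \<open>A ** P = A ** Q\<close>; then
      \<open>P ** A = mat 1\<close> cancels \<open>A\<close>.\<close>
    have "A ** P = (A ** Q) ** (A ** P)" by (simp only: matrix_mul_assoc Q)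
    then have "transpose (A ** P) = transpose ((A ** Q) ** (A ** P))" by (rule arg_cong)
    then have "A ** P = (A ** P) ** (A ** Q)"
      using P Q by (simp only: matrix_transpose_mul[of "A ** Q"])
    also have "\<dots> = A ** Q" by (simp only: matrix_mul_assoc P)
    finally have "P ** (A ** P) = P ** (A ** Q)" by (rule arg_cong)
    then have "P ** A ** P = P ** A ** Q" by (simp only: matrix_mul_assoc)
    then show ?thesis using left P by (simp only: matrix_mul_lid)
  qed
  ultimately have "\<exists>!P. ?penrose P" by blast
  from theI'[OF this] have "?penrose (pinv A)" by (simp only: pinv_def)
  then show "pinv A ** A = mat 1" "transpose (A ** pinv A) = A ** pinv A"
    using left by blast+
qed

text \<open>\<open>A ** pinv A\<close> is an orthogonal projection, hence a contraction; combine
  this with \<open>le\<close> at \<open>w = pinv A *v r\<close>.\<close>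

lemma norm_pinv_le:
  fixes A :: "real^'k^'l"
  assumes t: "0 < t" and le: "\<And>w. t * (w \<bullet> w) \<le> (norm (A *v w))\<^sup>2"
  shows "t * (norm (pinv A *v r))\<^sup>2 \<le> (norm r)\<^sup>2" and "pinv A ** A = mat 1"
proof -
  have "w = 0" if "A *v w = 0" for w
  proof (rule ccontr)
    assume "w \<noteq> 0"
    then have "0 < t * (w \<bullet> w)" using t by simp
    with le[of w] that show False by simp
  qed
  then have inj: "inj ((*v) A)"
    using linear_injective_0[OF matrix_vector_mul_linear[of A]] by blast
  note pinv = pinv_full_column_rank[OF inj]
  show "pinv A ** A = mat 1" by (rule pinv(1))
  let ?H = "A ** pinv A"
  have "?H ** ?H = A ** (pinv A ** A) ** pinv A" by (simp only: matrix_mul_assoc)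
  then have idem: "?H ** ?H = ?H" by (simp only: pinv(1) matrix_mul_rid)
  have "(norm (?H *v r))\<^sup>2 = r \<bullet> ((transpose ?H ** ?H) *v r)"
    by (rule norm_mult_eq_gram_quadratic)
  also have "\<dots> = r \<bullet> (?H *v r)" by (simp only: pinv(2) idem)
  also have "\<dots> \<le> norm r * norm (?H *v r)" by (rule norm_cauchy_schwarz)
  finally have "norm (?H *v r) \<le> norm r"
    by (cases "norm (?H *v r) = 0") (simp_all add: power2_eq_square)
  then have H: "(norm (?H *v r))\<^sup>2 \<le> (norm r)\<^sup>2" by (simp add: power_mono)
  have "t * (norm (pinv A *v r))\<^sup>2 \<le> (norm (A *v (pinv A *v r)))\<^sup>2"
    using le by (simp add: power2_norm_eq_inner)
  also have "\<dots> \<le> (norm r)\<^sup>2" using H by (simp add: matrix_vector_mul_assoc)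
  finally show "t * (norm (pinv A *v r))\<^sup>2 \<le> (norm r)\<^sup>2" .
qed

section \<open>Least squares under the true distribution\<close>

lemma integrable_mult_of_squares:
  fixes f g :: "'a \<Rightarrow> real"
  assumes [measurable]: "f \<in> borel_measurable M" "g \<in> borel_measurable M"
    and "integrable M (\<lambda>x. (f x)\<^sup>2)" "integrable M (\<lambda>x. (g x)\<^sup>2)"
  shows "integrable M (\<lambda>x. f x * g x)"
proof (rule Bochner_Integration.integrable_bound)
  show "integrable M (\<lambda>x. (f x)\<^sup>2 + (g x)\<^sup>2)" using assms by simp
  show "AE x in M. norm (f x * g x) \<le> norm ((f x)\<^sup>2 + (g x)\<^sup>2)"
  proof (rule AE_I2)
    fix x
    have "2 * (\<bar>f x\<bar> * \<bar>g x\<bar>) \<le> (f x)\<^sup>2 + (g x)\<^sup>2"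
      using sum_squares_bound[of "\<bar>f x\<bar>" "\<bar>g x\<bar>"] by (simp add: mult.assoc)
    moreover have "0 \<le> \<bar>f x\<bar> * \<bar>g x\<bar>" by simp
    ultimately show "norm (f x * g x) \<le> norm ((f x)\<^sup>2 + (g x)\<^sup>2)"
      unfolding real_norm_def abs_mult by linarith
  qed
qed measurable

locale square_integrable_features =
  fixes M :: "'a measure" and f :: "'a \<Rightarrow> real^'k" and R :: "real^'k^'k"
  assumes f_measurable [measurable]: "\<And>k. (\<lambda>x. f x $ k) \<in> borel_measurable M"
    and f_square: "\<And>k. integrable M (\<lambda>x. (f x $ k)\<^sup>2)"
    and R_def: "R = (\<chi> k \<kappa>. \<integral>x. f x $ k * f x $ \<kappa> \<partial>M)"
begin

lemma measurable_inner_f [measurable]: "(\<lambda>x. v \<bullet> f x) \<in> borel_measurable M"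
  unfolding inner_vec_def by simp

lemma square_integrable_inner: "integrable M (\<lambda>x. (v \<bullet> f x)\<^sup>2)"
proof (rule Bochner_Integration.integrable_bound)
  show "integrable M (\<lambda>x. (v \<bullet> v) * (\<Sum>k\<in>UNIV. (f x $ k)\<^sup>2))"
    by (intro integrable_mult_right Bochner_Integration.integrable_sum f_square)
  show "AE x in M. norm ((v \<bullet> f x)\<^sup>2) \<le> norm ((v \<bullet> v) * (\<Sum>k\<in>UNIV. (f x $ k)\<^sup>2))"
    using Cauchy_Schwarz_ineq[of v] by (simp add: inner_vec_def power2_eq_square sum_nonneg)
qed measurable

lemma integral_mult_inner:
  assumes [measurable]: "g \<in> borel_measurable M" and g: "integrable M (\<lambda>x. (g x)\<^sup>2)"
  shows "(\<integral>x. g x * (v \<bullet> f x) \<partial>M) = v \<bullet> (\<chi> k. \<integral>x. g x * f x $ k \<partial>M)"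
proof -
  have "integrable M (\<lambda>x. g x * f x $ k)" for k
    by (intro integrable_mult_of_squares g f_square) measurable
  then have "(\<integral>x. (\<Sum>k\<in>UNIV. v $ k * (g x * f x $ k)) \<partial>M) = (\<Sum>k\<in>UNIV. v $ k * (\<integral>x. g x * f x $ k \<partial>M))"
    by simp
  then show ?thesis
    by (simp add: inner_vec_def sum_distrib_left mult_ac)
qed

lemma transpose_R: "transpose R = R"
  by (simp add: R_def transpose_def vec_eq_iff mult.commute)

lemma integral_inner_inner: "(\<integral>x. (w \<bullet> f x) * (v \<bullet> f x) \<partial>M) = v \<bullet> (R *v w)"
proof -
  have "(\<integral>x. f x $ k * (w \<bullet> f x) \<partial>M) = w \<bullet> R $ k" for k
    using integral_mult_inner[OF f_measurable f_square] by (simp add: R_def)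
  then have "(\<chi> k. \<integral>x. (w \<bullet> f x) * f x $ k \<partial>M) = R *v w"
    by (simp add: vec_eq_iff matrix_vector_mult_def inner_vec_def mult.commute)
  then show ?thesis
    by (subst integral_mult_inner[OF measurable_inner_f square_integrable_inner]) simp
qed

lemma integrable_residual:
  assumes [measurable]: "y \<in> borel_measurable M" and y: "integrable M (\<lambda>x. (y x)\<^sup>2)"
  shows "integrable M (\<lambda>x. (y x - v \<bullet> f x)\<^sup>2)"
proof -
  have "integrable M (\<lambda>x. (y x)\<^sup>2 - 2 * (y x * (v \<bullet> f x)) + (v \<bullet> f x)\<^sup>2)"
    by (intro Bochner_Integration.integrable_add Bochner_Integration.integrable_diff
        integrable_mult_right integrable_mult_of_squares y square_integrable_inner) measurable
  then show ?thesis by (simp add: power2_diff algebra_simps)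
qed

text \<open>\<open>a\<close> solves the normal equations, so its residual is orthogonal to every
  combination of the features and the cross term vanishes.\<close>

lemma least_squares_pythagoras:
  assumes [measurable]: "y \<in> borel_measurable M" and y: "integrable M (\<lambda>x. (y x)\<^sup>2)"
    and R: "invertible R"
  obtains a where "\<And>v. (\<integral>x. (y x - v \<bullet> f x)\<^sup>2 \<partial>M)
      = (\<integral>x. (y x - a \<bullet> f x)\<^sup>2 \<partial>M) + (v - a) \<bullet> (R *v (v - a))"
proof -
  obtain B where B: "R ** B = mat 1" using R by (auto simp: invertible_def)
  define c where "c = (\<chi> k. \<integral>x. y x * f x $ k \<partial>M)"
  define a where "a = B *v c"
  have a: "R *v a = c"
    by (simp add: a_def matrix_vector_mul_assoc B)
  show ?thesis
  proof (rule that[of a])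
    fix v
    let ?w = "v - a"
    have int: "integrable M (\<lambda>x. (y x - a \<bullet> f x) * (?w \<bullet> f x))"
      by (intro integrable_mult_of_squares integrable_residual y square_integrable_inner) measurable
    have "(\<integral>x. (y x - a \<bullet> f x) * (?w \<bullet> f x) \<partial>M)
        = (\<integral>x. y x * (?w \<bullet> f x) - (a \<bullet> f x) * (?w \<bullet> f x) \<partial>M)"
      by (simp add: left_diff_distrib)
    also have "\<dots> = (\<integral>x. y x * (?w \<bullet> f x) \<partial>M) - (\<integral>x. (a \<bullet> f x) * (?w \<bullet> f x) \<partial>M)"
      by (intro Bochner_Integration.integral_diff integrable_mult_of_squares y square_integrable_inner) measurable
    also have "\<dots> = 0"
      by (simp add: integral_mult_inner[OF _ y] integral_inner_inner a c_def[symmetric])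
    finally have orth: "(\<integral>x. (y x - a \<bullet> f x) * (?w \<bullet> f x) \<partial>M) = 0" .
    have "(\<integral>x. (y x - v \<bullet> f x)\<^sup>2 \<partial>M)
        = (\<integral>x. (y x - a \<bullet> f x)\<^sup>2 - 2 * ((y x - a \<bullet> f x) * (?w \<bullet> f x)) + (?w \<bullet> f x)\<^sup>2 \<partial>M)"
      by (intro Bochner_Integration.integral_cong refl)
        (simp add: inner_diff_left power2_eq_square algebra_simps)
    also have "\<dots> = (\<integral>x. (y x - a \<bullet> f x)\<^sup>2 \<partial>M) + (\<integral>x. (?w \<bullet> f x)\<^sup>2 \<partial>M)"
      using int by (simp add: integrable_residual y square_integrable_inner orth)
    also have "(\<integral>x. (?w \<bullet> f x)\<^sup>2 \<partial>M) = ?w \<bullet> (R *v ?w)"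
      using integral_inner_inner[of ?w ?w] by (simp add: power2_eq_square)
    finally show "(\<integral>x. (y x - v \<bullet> f x)\<^sup>2 \<partial>M)
        = (\<integral>x. (y x - a \<bullet> f x)\<^sup>2 \<partial>M) + ?w \<bullet> (R *v ?w)" .
  qed
qed

end

subsection \<open>Risk of the truncated least-squares estimator\<close>

theorem theorem4p1:
  fixes \<mu> :: "'d::euclidean_space measure"
    and y :: "'d \<Rightarrow> real"
    and \<eta> :: "'d \<Rightarrow> real^'k"
    and lam_lo lam_hi \<epsilon> m :: real
    and R :: "real^'k^'k"
  assumes prob: "prob_space \<mu>"
    and sets_\<mu>: "sets \<mu> = sets borel"
    and y_meas: "y \<in> borel_measurable \<mu>"
    and y_sq: "integrable \<mu> (\<lambda>x. (y x)\<^sup>2)"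
    and eta_meas: "\<And>k. (\<lambda>x. \<eta> x $ k) \<in> borel_measurable \<mu>"
    and eta_sq: "\<And>k. integrable \<mu> (\<lambda>x. (\<eta> x $ k)\<^sup>2)"
    and eta_bdd: "\<exists>B. \<forall>x k. \<bar>\<eta> x $ k\<bar> \<le> B"
    and R_def: "R = (\<chi> k \<kappa>. \<integral>x. \<eta> x $ k * \<eta> x $ \<kappa> \<partial>\<mu>)"
    and R_full: "invertible R"
    and lo_pos: "0 < lam_lo"
    and eig_bounds: "\<forall>c\<in>eigvals R. lam_lo \<le> c \<and> c \<le> lam_hi"
    and m_def: "m = (SUP x\<in>msupp \<mu>. \<Sum>k\<in>UNIV. \<bar>\<eta> x $ k\<bar>\<^sup>2)"
    and eps: "0 < \<epsilon>" "\<epsilon> < 1"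
  shows "(\<integral>\<^sup>+ xs. (\<integral>\<^sup>+ x. ennreal ((y x - alg2_est ((1 - \<epsilon>) * lam_lo) \<eta> y xs x)\<^sup>2) \<partial>\<mu>)
            \<partial>(PiM (UNIV :: 'l::finite set) (\<lambda>_. \<mu>)))
    \<le> ennreal ((1 + lam_hi / (lam_lo * (1 - \<epsilon>))) *
                 (INF \<alpha>. \<integral>x. (y x - \<alpha> \<bullet> \<eta> x)\<^sup>2 \<partial>\<mu>)
         + 2 * real CARD('k) *
             exp (- (3 * \<epsilon>\<^sup>2 * real CARD('l)) /
                  (6 * m * lam_hi / lam_lo\<^sup>2 + 2 * \<epsilon> * (m / lam_lo + lam_hi / lam_lo)))
           * (\<integral>x. (y x)\<^sup>2 \<partial>\<mu>))"
proof -
  interpret prob_space \<mu> by (rule prob)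
  interpret feat: square_integrable_features \<mu> \<eta> R
    by unfold_locales (rule eta_meas eta_sq R_def)+
  let ?L = "real CARD('l)" and ?K = "real CARD('k)"
  let ?P = "Pi\<^sub>M (UNIV :: 'l set) (\<lambda>_. \<mu>)"
  define \<tau> where "\<tau> = (1 - \<epsilon>) * lam_lo"
  have \<tau>: "0 < \<tau>" using lo_pos eps by (simp add: \<tau>_def)
  have L: "0 < ?L" by simp
  have R_ge: "lam_lo * (w \<bullet> w) \<le> w \<bullet> (R *v w)" for w
    using eig_bounds by (intro Rayleigh_ge feat.transpose_R) auto
  have R_le: "w \<bullet> (R *v w) \<le> lam_hi * (w \<bullet> w)" for w
    using eig_bounds by (intro Rayleigh_le feat.transpose_R) auto
  have lo_le_hi: "lam_lo \<le> lam_hi"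
    using eigvals_nonempty[OF feat.transpose_R] eig_bounds by fastforce
  have quad: "(\<integral>x. (\<eta> x \<bullet> v)\<^sup>2 \<partial>\<mu>) = v \<bullet> (R *v v)" for v
    using feat.integral_inner_inner[of v v] by (simp add: power2_eq_square inner_commute)

  obtain B where B: "\<And>x k. \<bar>\<eta> x $ k\<bar> \<le> B" using eta_bdd by blast
  have inner_eta: "\<eta> x \<bullet> \<eta> x = (\<Sum>k\<in>UNIV. \<bar>\<eta> x $ k\<bar>\<^sup>2)" for x
    by (simp add: inner_vec_def power2_eq_square)
  have bdd: "\<eta> x \<bullet> \<eta> x \<le> ?K * B\<^sup>2" for x
    unfolding inner_eta by (intro sum_bounded_above power_mono B abs_ge_zero)
  have AE_m: "AE x in \<mu>. \<eta> x \<bullet> \<eta> x \<le> m"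
    using AE_in_msupp[OF finite_measure_axioms sets_\<mu>]
  proof (rule AE_mp, intro AE_I2 impI)
    fix x assume "x \<in> msupp \<mu>"
    moreover have "bdd_above ((\<lambda>x. \<Sum>k\<in>UNIV. \<bar>\<eta> x $ k\<bar>\<^sup>2) ` msupp \<mu>)"
      using bdd unfolding inner_eta by (intro bdd_aboveI2)
    ultimately show "\<eta> x \<bullet> \<eta> x \<le> m" unfolding m_def inner_eta by (rule cSUP_upper)
  qed
  \<comment> \<open>The second moment of a single feature lies between \<open>lam_lo\<close> and
    \<open>m\<close>. In particular \<open>m\<close> is positive, as the Chernoff bound
    requires.\<close>
  have m_ge: "lam_lo \<le> m"
  proof -
    fix k :: 'k
    let ?v = "axis k (1::real)"
    have "lam_lo \<le> (\<integral>x. (\<eta> x \<bullet> ?v)\<^sup>2 \<partial>\<mu>)"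
      using R_ge[of ?v] by (simp add: quad inner_axis_axis)
    also have "\<dots> \<le> (\<integral>x. m \<partial>\<mu>)"
    proof (rule integral_mono_AE)
      show "integrable \<mu> (\<lambda>x. (\<eta> x \<bullet> ?v)\<^sup>2)"
        using feat.square_integrable_inner[of ?v] by (simp only: inner_commute)
      have "(\<eta> x \<bullet> ?v)\<^sup>2 \<le> \<eta> x \<bullet> \<eta> x" for x
        using Cauchy_Schwarz_ineq[of "\<eta> x" ?v] by (simp add: inner_axis_axis)
      with AE_m show "AE x in \<mu>. (\<eta> x \<bullet> ?v)\<^sup>2 \<le> m"
        by (auto elim!: eventually_mono intro: order_trans)
    qed simp
    finally show ?thesis by (simp add: prob_space)
  qed

  interpret bf: bounded_feature_map \<mu> \<eta> lam_lo m "?K * B\<^sup>2"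
    by unfold_locales (use eta_meas bdd AE_m R_ge quad lo_pos m_ge in auto)
  define E where "E = {xs \<in> space ?P. \<exists>v. norm v = 1 \<and>
      v \<bullet> (gram UNIV (\<lambda>l. \<eta> (xs l)) *v v) < ?L * ((1 - \<epsilon>) * lam_lo)}"
  have E: "E \<in> sets ?P"
    and prob_E: "measure ?P E \<le> ?K * exp (- (\<epsilon>\<^sup>2 * ?L * lam_lo / (2 * m)))"
    unfolding E_def by (rule bf.prob_gram_small[OF eps])+
  interpret P: prob_space ?P by (intro prob_space_PiM) unfold_locales

  define J where "J v = (\<integral>x. (y x - v \<bullet> \<eta> x)\<^sup>2 \<partial>\<mu>)" for v
  define Y2 where "Y2 = (\<integral>x. (y x)\<^sup>2 \<partial>\<mu>)"
  have Y2: "0 \<le> Y2" by (simp add: Y2_def)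
  have J_nonneg: "0 \<le> J v" for v by (simp add: J_def)
  have nn_J: "(\<integral>\<^sup>+ x. ennreal ((y x - v \<bullet> \<eta> x)\<^sup>2) \<partial>\<mu>) = ennreal (J v)" for v
    unfolding J_def by (intro nn_integral_eq_integral feat.integrable_residual y_meas y_sq) simp
  obtain a where a: "\<And>v. J v = J a + (v - a) \<bullet> (R *v (v - a))"
    using feat.least_squares_pythagoras[OF y_meas y_sq R_full] unfolding J_def by blast
  have J_le_INF: "J a \<le> (INF v. J v)"
  proof (rule cINF_greatest)
    fix v
    have "0 \<le> lam_lo * ((v - a) \<bullet> (v - a))" using lo_pos by simp
    then show "J a \<le> J v" using a[of v] R_ge[of "v - a"] by linarith
  qed simp
  define \<rho> where "\<rho> x = (y x - a \<bullet> \<eta> x)\<^sup>2" for x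
  have \<rho>_meas [measurable]: "\<rho> \<in> borel_measurable \<mu>"
    unfolding \<rho>_def using y_meas by measurable
  \<comment> \<open>\<open>1 / (?L * \<tau>)\<close> comes from the pseudoinverse bound, and
    \<open>lam_hi\<close> converts a squared coefficient error into excess risk.\<close>
  define c where "c = lam_hi / (?L * \<tau>)"
  have c: "0 \<le> c" using lo_le_hi lo_pos \<tau> by (simp add: c_def)

  \<comment> \<open>One bound covers both branches of the algorithm: the residual sum pays for an
    accepted sample, the indicator of \<open>E\<close> for a rejected one.\<close>
  have pointwise: "(\<integral>\<^sup>+ x. ennreal ((y x - alg2_est \<tau> \<eta> y xs x)\<^sup>2) \<partial>\<mu>)
      \<le> ennreal (J a) + ennreal c * (\<Sum>l\<in>UNIV. ennreal (\<rho> (xs l))) + ennreal Y2 * indicator E xs"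
    if xs: "xs \<in> space ?P" for xs :: "'l \<Rightarrow> 'd"
  proof -
    let ?A = "design_matrix \<eta> xs"
    show ?thesis
    proof (cases "?L * \<tau> \<le> min_sing_sq ?A")
      case True
      let ?Y = "\<chi> l. y (xs l)"
      let ?r = "?Y - ?A *v a"
      let ?d = "pinv ?A *v ?Y - a"
      have coeff: "alg2_coeff \<tau> \<eta> y xs = pinv ?A *v ?Y"
        using True by (simp add: alg2_coeff_def)
      have t: "0 < ?L * \<tau>" using \<tau> by simp
      note pinv = norm_pinv_le[OF t min_sing_sq_ge_imp[OF True]]
      \<comment> \<open>Since \<open>pinv ?A ** ?A = mat 1\<close>, the vector \<open>a\<close> can
        be moved inside, and the coefficient error depends on the responses only through the
        residuals of \<open>a\<close>.\<close>
      have "?d = pinv ?A *v ?r"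
        by (simp add: matrix_vector_mult_diff_distrib matrix_vector_mul_assoc pinv(2))
      then have "?L * \<tau> * (norm ?d)\<^sup>2 \<le> (norm ?r)\<^sup>2"
        using pinv(1)[of ?r] by simp
      also have "(norm ?r)\<^sup>2 = (\<Sum>l\<in>UNIV. \<rho> (xs l))"
        unfolding power2_norm_eq_inner
        by (simp add: inner_vec_def \<rho>_def power2_eq_square matrix_vector_mult_def design_matrix_def mult.commute)
      finally have "(norm ?d)\<^sup>2 \<le> (\<Sum>l\<in>UNIV. \<rho> (xs l)) / (?L * \<tau>)"
        using t by (simp only: pos_le_divide_eq mult.commute)
      then have "lam_hi * (norm ?d)\<^sup>2 \<le> lam_hi * ((\<Sum>l\<in>UNIV. \<rho> (xs l)) / (?L * \<tau>))"
        using lo_le_hi lo_pos by (intro mult_left_mono) auto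
      also have "\<dots> = c * (\<Sum>l\<in>UNIV. \<rho> (xs l))" by (simp add: c_def)
      finally have "J (pinv ?A *v ?Y) \<le> J a + c * (\<Sum>l\<in>UNIV. \<rho> (xs l))"
        using a[of "pinv ?A *v ?Y"] R_le[of ?d] unfolding power2_norm_eq_inner by linarith
      then have "ennreal (J (pinv ?A *v ?Y)) \<le> ennreal (J a + c * (\<Sum>l\<in>UNIV. \<rho> (xs l)))"
        by (rule ennreal_leI)
      also have "\<dots> = ennreal (J a) + ennreal c * (\<Sum>l\<in>UNIV. ennreal (\<rho> (xs l)))"
        using J_nonneg[of a] c
        by (subst sum_ennreal) (auto simp: \<rho>_def sum_nonneg ennreal_plus ennreal_mult)
      finally show ?thesis
        unfolding alg2_est_def coeff nn_J by (rule order_trans) simp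
    next
      case False
      then have "xs \<in> E"
        using min_sing_sq_less_imp[of ?A "?L * \<tau>"] xs
        unfolding E_def \<tau>_def gram_eq_transpose_mult by auto
      \<comment> \<open>The zero coefficient vector has risk \<open>J 0\<close>, the second moment
        of \<open>y\<close>.\<close>
      moreover have "alg2_coeff \<tau> \<eta> y xs = 0" using False by (simp add: alg2_coeff_def)
      moreover have "J 0 = Y2" by (simp add: J_def Y2_def)
      ultimately show ?thesis
        unfolding alg2_est_def nn_J by simp
    qed
  qed

  \<comment> \<open>Every coordinate of the product has law \<open>\<mu>\<close>. The sum of the
    \<open>?L\<close> equal means cancels the \<open>?L\<close> in \<open>c\<close>, leaving
    \<open>lam_hi / \<tau>\<close>.\<close>
  have comp: "(\<integral>\<^sup>+ xs. ennreal (\<rho> (xs l)) \<partial>?P) = ennreal (J a)" for l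
  proof -
    have "(\<integral>\<^sup>+ xs. ennreal (\<rho> (xs l)) \<partial>?P) = (\<integral>\<^sup>+ x. ennreal (\<rho> x) \<partial>distr ?P \<mu> (\<lambda>xs. xs l))"
      by (subst nn_integral_distr) auto
    also have "distr ?P \<mu> (\<lambda>xs. xs l) = \<mu>"
      by (rule distr_PiM_component) (auto intro: prob)
    finally show ?thesis by (simp add: \<rho>_def nn_J)
  qed
  have \<rho>_comp [measurable]: "(\<lambda>xs. ennreal (\<rho> (xs l))) \<in> borel_measurable ?P" for l
    by (rule measurable_compose[OF measurable_component_singleton]) auto
  note E [measurable]
  have "(\<integral>\<^sup>+ xs. (\<integral>\<^sup>+ x. ennreal ((y x - alg2_est \<tau> \<eta> y xs x)\<^sup>2) \<partial>\<mu>) \<partial>?P)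
      \<le> (\<integral>\<^sup>+ xs. ennreal (J a) + ennreal c * (\<Sum>l\<in>UNIV. ennreal (\<rho> (xs l))) + ennreal Y2 * indicator E xs \<partial>?P)"
    by (intro nn_integral_mono pointwise)
  also have "\<dots> = ennreal (J a) + ennreal c * (\<Sum>l\<in>(UNIV::'l set). ennreal (J a)) + ennreal Y2 * emeasure ?P E"
    by (simp add: nn_integral_add nn_integral_cmult nn_integral_sum comp P.emeasure_space_1)
  also have "\<dots> = ennreal (J a + c * (?L * J a) + Y2 * measure ?P E)"
    using c Y2 J_nonneg[of a]
    by (simp add: P.emeasure_eq_measure ennreal_plus ennreal_mult ennreal_of_nat_eq_real_of_nat)
  also have "\<dots> \<le> ennreal ((1 + lam_hi / (lam_lo * (1 - \<epsilon>))) * (INF v. J v)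
      + 2 * ?K * exp (- (3 * \<epsilon>\<^sup>2 * ?L) /
          (6 * m * lam_hi / lam_lo\<^sup>2 + 2 * \<epsilon> * (m / lam_lo + lam_hi / lam_lo))) * Y2)"
  proof (intro ennreal_leI add_mono)
    have "J a + c * (?L * J a) = (1 + lam_hi / \<tau>) * J a"
      using L \<tau> by (simp add: c_def field_simps)
    also have "\<dots> \<le> (1 + lam_hi / \<tau>) * (INF v. J v)"
      using J_le_INF lo_le_hi lo_pos \<tau> by (intro mult_left_mono) auto
    finally show "J a + c * (?L * J a) \<le> (1 + lam_hi / (lam_lo * (1 - \<epsilon>))) * (INF v. J v)"
      by (simp add: \<tau>_def mult.commute)
    let ?D = "6 * m * lam_hi / lam_lo\<^sup>2 + 2 * \<epsilon> * (m / lam_lo + lam_hi / lam_lo)"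
    have m: "0 < m" using lo_pos m_ge by simp
    \<comment> \<open>From \<open>lam_lo \<le> lam_hi\<close> the claimed denominator is at least
      \<open>6 * m / lam_lo\<close>, so the claimed exponential is no smaller than the Chernoff
      one.\<close>
    have "6 * m / lam_lo \<le> 6 * m * lam_hi / lam_lo\<^sup>2"
      using lo_le_hi lo_pos m by (simp add: field_simps power2_eq_square)
    moreover have "0 \<le> 2 * \<epsilon> * (m / lam_lo + lam_hi / lam_lo)"
      using lo_le_hi lo_pos m eps by simp
    ultimately have D: "6 * m / lam_lo \<le> ?D" by linarith
    have "0 < 6 * m / lam_lo" using m lo_pos by simp
    then have "3 * \<epsilon>\<^sup>2 * ?L / ?D \<le> 3 * \<epsilon>\<^sup>2 * ?L / (6 * m / lam_lo)"
      using D by (intro divide_left_mono mult_pos_pos) auto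
    also have "\<dots> = \<epsilon>\<^sup>2 * ?L * lam_lo / (2 * m)"
      using m lo_pos by (simp add: field_simps)
    finally have "exp (- (\<epsilon>\<^sup>2 * ?L * lam_lo / (2 * m))) \<le> exp (- (3 * \<epsilon>\<^sup>2 * ?L) / ?D)" by simp
    then have "measure ?P E \<le> ?K * exp (- (3 * \<epsilon>\<^sup>2 * ?L) / ?D)"
      by (intro order_trans[OF prob_E] mult_left_mono) auto
    also have "\<dots> \<le> 2 * ?K * exp (- (3 * \<epsilon>\<^sup>2 * ?L) / ?D)" by simp
    finally show "Y2 * measure ?P E \<le> 2 * ?K * exp (- (3 * \<epsilon>\<^sup>2 * ?L) / ?D) * Y2"
      using Y2 by (subst mult.commute) (rule mult_right_mono)
  qed
  finally show ?thesis unfolding J_def Y2_def \<tau>_def .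
qed

end
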